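(* Let $p=md$ and let $$\mathcal{X}=\bigcup_{i=1}^m\{x\in\mathbb{R}^{md}: x \text{ has all coordinates zero outside the block of indices } (i-1)d+1,\dots,id\},$$ i.e. the union of the $m$ coordinate blocks $\{0_d\}\times\cdots\times\mathbb{R}^d\times\cdots\times\{0_d\}$. For $i=1,\dots,m$ let $T_i:\mathcal{X}\to\mathbb{R}^d$ be the projection onto coordinates $(i-1)d+1,\dots,id$. Let $H_n$ be generated by the adaptive linear Gaussian sampling procedure with a fixed sampling rule $\Lambda$, known variance $\sigma^2>0$ and true parameter $\beta_0\in\mathbb{R}^p$, and let $I_{n,i}=\sum_{j=1}^n T_i(x_j)T_i(x_j)^\top\in\mathbb{R}^{d\times d}$. Assume: (i) each $x_j\in\mathcal{X}$; (ii) for every $i=1,\dots,m$, $\lambda_{\min}(I_{n,i})\xrightarrow{p}\infty$ and $\log\lambda_{\max}(I_{n,i})=o_p(\lambda_{\min}(I_{n,i}))$; (iii) the prior $\pi$ is a continuous, bounded density on $\mathbb{R}^p$ with $\pi(\beta_0)>0$. Then, with $\hat\beta_n=(\mathbf{X}_n^\top\mathbf{X}_n)^{-1}\mathbf{X}_n^\top\mathbf{y}_n$, $$\big\|\pi(\cdot\mid H_n)-\mathcal{N}\big(\hat\beta_n,\sigma^2(\mathbf{X}_n^\top\mathbf{X}_n)^{-1}\big)\big\|_{\mathrm{TV}}\xrightarrow{p}0.$$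
   Context: Adaptive linear Gaussian sampling procedure: given a covariate sampling rule $\Lambda$ mapping any finite history $H_{j-1}=((x_1,y_1),\dots,(x_{j-1},y_{j-1}))$ to a probability distribution $\Lambda(\cdot\mid H_{j-1})$ on $\mathbb{R}^p$, set $H_0=\emptyset$ and for $j=1,\dots,n$: draw $x_j\sim\Lambda(\cdot\mid H_{j-1})$, then $y_j\sim\mathcal{N}(x_j^\top\beta_0,\sigma^2)$ conditionally on the past and $x_j$, and set $H_j=((x_1,y_1),\dots,(x_j,y_j))$. $\mathbf{X}_n$ is the $n\times p$ matrix with rows $x_j^\top$, $\mathbf{y}_n$ the vector of $y_j$, and $\pi(\beta\mid H_n)\propto\pi(\beta)\prod_{j=1}^n\exp(-(y_j-x_j^\top\beta)^2/(2\sigma^2))$. (This models a linear contextual bandit with $m$ arms and $d$-dimensional contexts, $\beta_0$ being the vertical stacking of per-arm parameter vectors.) $\lambda_{\min},\lambda_{\max}$ are extreme eigenvalues; $\|\cdot\|_{\mathrm{TV}}$ is total variation distance. *)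

theory Defs
  imports "HOL-Probability.Probability"
begin

definition outer :: "real^'n \<Rightarrow> real^'n \<Rightarrow> real^'n^'n" where
  "outer u v = (\<chi> a b. u $ a * v $ b)"

definition eigenvalues :: "real^'n^'n \<Rightarrow> real set" where
  "eigenvalues A = {c. \<exists>v. v \<noteq> 0 \<and> A *v v = c *\<^sub>R v}"

definition lambda_min :: "real^'n^'n \<Rightarrow> real" where
  "lambda_min A = Min (eigenvalues A)"

definition lambda_max :: "real^'n^'n \<Rightarrow> real" where
  "lambda_max A = Max (eigenvalues A)"

section \<open>Block structure: R^p with p = m d, coordinates indexed by 'm \<times> 'd\<close>

text \<open>Coordinate (i,l) corresponds to coordinate (i-1)d+l of R^{md}.\<close>
definition block :: "'m \<Rightarrow> (real^('m::finite \<times> 'd::finite)) set" where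
  "block i = {x. \<forall>k l. k \<noteq> i \<longrightarrow> x $ (k, l) = 0}"

definition Xset :: "(real^('m::finite \<times> 'd::finite)) set" where
  "Xset = (\<Union>i. block i)"

definition T :: "'m \<Rightarrow> real^('m::finite \<times> 'd::finite) \<Rightarrow> real^'d" where
  "T i x = (\<chi> l. x $ (i, l))"

text \<open>A history of length n is an element of PiE {..<n} (j-th entry = (x_{j+1}, y_{j+1})).
  The sampling rule Lam j h is the law of x_{j+1} given the history h of length j.
  hist Lam beta0 sg n is the law of H_n.\<close>
primrec hist :: "(nat \<Rightarrow> (nat \<Rightarrow> 'v \<times> real) \<Rightarrow> 'v measure) \<Rightarrow> 'v::euclidean_space \<Rightarrow> real
    \<Rightarrow> nat \<Rightarrow> (nat \<Rightarrow> 'v \<times> real) measure" where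
  "hist Lam beta0 sg 0 = return (PiM {..<0} (\<lambda>_. borel)) (\<lambda>_. undefined)"
| "hist Lam beta0 sg (Suc n) =
     bind (hist Lam beta0 sg n) (\<lambda>h.
       bind (Lam n h) (\<lambda>x.
         bind (density lborel (normal_density (x \<bullet> beta0) sg)) (\<lambda>y.
           return (PiM {..<Suc n} (\<lambda>_. borel)) (h(n := (x, y))))))"

definition XtX :: "nat \<Rightarrow> (nat \<Rightarrow> (real^'n) \<times> real) \<Rightarrow> real^'n^'n" where
  "XtX n h = (\<Sum>j<n. outer (fst (h j)) (fst (h j)))"

definition Xty :: "nat \<Rightarrow> (nat \<Rightarrow> (real^'n) \<times> real) \<Rightarrow> real^'n" where
  "Xty n h = (\<Sum>j<n. snd (h j) *\<^sub>R fst (h j))"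

definition beta_hat :: "nat \<Rightarrow> (nat \<Rightarrow> (real^'n) \<times> real) \<Rightarrow> real^'n" where
  "beta_hat n h = matrix_inv (XtX n h) *v Xty n h"

definition info_block :: "'m \<Rightarrow> nat \<Rightarrow> (nat \<Rightarrow> (real^('m::finite \<times> 'd::finite)) \<times> real) \<Rightarrow> real^'d^'d" where
  "info_block i n h = (\<Sum>j<n. outer (T i (fst (h j))) (T i (fst (h j))))"

definition likelihood :: "real \<Rightarrow> nat \<Rightarrow> (nat \<Rightarrow> 'v::euclidean_space \<times> real) \<Rightarrow> 'v \<Rightarrow> real" where
  "likelihood sg n h beta = (\<Prod>j<n. exp (- (snd (h j) - fst (h j) \<bullet> beta)\<^sup>2 / (2 * sg\<^sup>2)))"

definition posterior :: "('v::euclidean_space \<Rightarrow> real) \<Rightarrow> real \<Rightarrow> nat \<Rightarrow> (nat \<Rightarrow> 'v \<times> real) \<Rightarrow> 'v measure" where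
  "posterior prior sg n h =
     (let Z = (\<integral>b. prior b * likelihood sg n h b \<partial>lborel)
      in density lborel (\<lambda>b. ennreal (prior b * likelihood sg n h b / Z)))"

definition mvn_density :: "real^'n \<Rightarrow> real^'n^'n \<Rightarrow> real^'n \<Rightarrow> real" where
  "mvn_density mu S b =
     exp (- ((b - mu) \<bullet> (matrix_inv S *v (b - mu))) / 2) / sqrt ((2 * pi) ^ CARD('n) * det S)"

definition mvn :: "real^'n \<Rightarrow> real^'n^'n \<Rightarrow> (real^'n) measure" where
  "mvn mu S = density lborel (\<lambda>b. ennreal (mvn_density mu S b))"

definition tv_dist :: "'a::topological_space measure \<Rightarrow> 'a measure \<Rightarrow> real" where
  "tv_dist M N = (SUP A \<in> sets borel. \<bar>measure M A - measure N A\<bar>)"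

section \<open>Convergence in probability (via outer probability of the bad events)\<close>

definition conv_prob_zero :: "(nat \<Rightarrow> 'h measure) \<Rightarrow> (nat \<Rightarrow> 'h \<Rightarrow> real) \<Rightarrow> bool" where
  "conv_prob_zero M Z \<longleftrightarrow> (\<forall>\<epsilon>>0. \<forall>\<delta>>0. \<exists>N. \<forall>n\<ge>N. \<exists>B\<in>sets (M n).
      {h \<in> space (M n). \<epsilon> < \<bar>Z n h\<bar>} \<subseteq> B \<and> measure (M n) B < \<delta>)"

definition conv_prob_infty :: "(nat \<Rightarrow> 'h measure) \<Rightarrow> (nat \<Rightarrow> 'h \<Rightarrow> real) \<Rightarrow> bool" where
  "conv_prob_infty M Z \<longleftrightarrow> (\<forall>K. \<forall>\<delta>>0. \<exists>N. \<forall>n\<ge>N. \<exists>B\<in>sets (M n).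
      {h \<in> space (M n). Z n h \<le> K} \<subseteq> B \<and> measure (M n) B < \<delta>)"

end

theory Submission
  imports Defs
begin

text \<open>
  Up to normalisation the posterior is the prior times the Gaussian density \<open>N(beta_hat, sg\<^sup>2 G\<^sup>-\<^sup>1)\<close>
  with \<open>G = XtX\<close>, so the total variation distance is small as soon as that Gaussian concentrates near
  \<open>beta0\<close>, where the prior is almost constant. As \<open>\<lambda>\<^sub>m\<^sub>i\<^sub>n(G) \<rightarrow> \<infinity>\<close>, it concentrates
  around \<open>beta_hat\<close>, and what remains is consistency of \<open>beta_hat\<close>.

  On block-supported designs \<open>G\<close> is block diagonal, and consistency is proved block by block. The
  likelihood ratio of \<open>beta0 + b\<close> against \<open>beta0\<close> has expectation 1 for every \<open>b\<close>, however adaptive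
  the design; hence its integral over a fixed ball of directions \<open>b\<close> in block \<open>i\<close> is bounded in
  probability. If \<open>beta_hat\<close> were at distance more than \<open>\<delta>\<close> from \<open>beta0\<close> in block \<open>i\<close>, this integral
  would be at least of order \<open>\<lambda>\<^sub>m\<^sub>a\<^sub>x\<^sup>-\<^sup>d\<^sup>/\<^sup>2 exp(\<delta>\<^sup>2 \<lambda>\<^sub>m\<^sub>i\<^sub>n / (2 sg\<^sup>2))\<close>,
  which tends to infinity because \<open>log \<lambda>\<^sub>m\<^sub>a\<^sub>x = o(\<lambda>\<^sub>m\<^sub>i\<^sub>n)\<close>.
\<close>

section \<open>Linear change of variables and Gaussian integrals\<close>

text \<open>Split off the coordinate along \<open>a\<close> by Tonelli. With the other coordinates
  fixed, \<open>g\<close> is constant on the line in direction \<open>a\<close>, so the inner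
  integral is only translated.\<close>

lemma nn_integral_lborel_shear:
  fixes a :: "'a::euclidean_space"
  assumes a: "a \<in> Basis" and [measurable]: "g \<in> borel_measurable borel" "f \<in> borel_measurable borel"
    and g: "\<And>x t. g (x + t *\<^sub>R a) = g x"
  shows "(\<integral>\<^sup>+x. f (x + g x *\<^sub>R a) \<partial>lborel) = (\<integral>\<^sup>+x. f x \<partial>lborel)"
proof -
  interpret product_sigma_finite "\<lambda>_::'a. lborel :: real measure" ..
  let ?B = "Basis - {a}"
  let ?s = "\<lambda>x. \<Sum>b\<in>?B. x b *\<^sub>R b"
  have split: "(\<integral>\<^sup>+x. h x \<partial>lborel) = (\<integral>\<^sup>+x. \<integral>\<^sup>+y. h (?s x + y *\<^sub>R a) \<partial>lborel \<partial>PiM ?B (\<lambda>_. lborel))"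
    if [measurable]: "h \<in> borel_measurable borel" for h :: "'a \<Rightarrow> ennreal"
  proof -
    have "(\<integral>\<^sup>+x. h x \<partial>lborel) = (\<integral>\<^sup>+x. h (\<Sum>b\<in>Basis. x b *\<^sub>R b) \<partial>PiM Basis (\<lambda>_. lborel))"
      by (subst lborel_eq) (simp add: nn_integral_distr)
    also have "\<dots> = (\<integral>\<^sup>+x. h (\<Sum>b\<in>insert a ?B. x b *\<^sub>R b) \<partial>PiM (insert a ?B) (\<lambda>_. lborel))"
      using a by (simp add: insert_absorb)
    also have "\<dots> = (\<integral>\<^sup>+x. \<integral>\<^sup>+y. h (\<Sum>b\<in>insert a ?B. (x(a := y)) b *\<^sub>R b) \<partial>lborel \<partial>PiM ?B (\<lambda>_. lborel))"
      by (subst product_nn_integral_insert) auto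
    also have "\<dots> = (\<integral>\<^sup>+x. \<integral>\<^sup>+y. h (?s x + y *\<^sub>R a) \<partial>lborel \<partial>PiM ?B (\<lambda>_. lborel))"
    proof (intro nn_integral_cong arg_cong[of _ _ h])
      fix x y
      have "(\<Sum>b\<in>?B. (x(a := y)) b *\<^sub>R b) = ?s x" by (rule sum.cong) auto
      then show "(\<Sum>b\<in>insert a ?B. (x(a := y)) b *\<^sub>R b) = ?s x + y *\<^sub>R a"
        by (subst sum.insert) (simp_all only: fun_upd_same add.commute, auto)
    qed
    finally show ?thesis .
  qed
  have "(\<integral>\<^sup>+x. f (x + g x *\<^sub>R a) \<partial>lborel)
      = (\<integral>\<^sup>+x. \<integral>\<^sup>+y. f (?s x + (g (?s x) + 1 * y) *\<^sub>R a) \<partial>lborel \<partial>PiM ?B (\<lambda>_. lborel))"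
    by (subst split) (simp_all add: g, simp add: scaleR_add_left add_ac)
  also have "\<dots> = (\<integral>\<^sup>+x. \<integral>\<^sup>+y. f (?s x + y *\<^sub>R a) \<partial>lborel \<partial>PiM ?B (\<lambda>_. lborel))"
  proof (rule nn_integral_cong)
    fix x
    show "(\<integral>\<^sup>+y. f (?s x + (g (?s x) + 1 * y) *\<^sub>R a) \<partial>lborel) = (\<integral>\<^sup>+y. f (?s x + y *\<^sub>R a) \<partial>lborel)"
      using nn_integral_real_affine[of "\<lambda>y. f (?s x + y *\<^sub>R a)" 1 "g (?s x)"] by simp
  qed
  also have "\<dots> = (\<integral>\<^sup>+x. f x \<partial>lborel)" by (rule split[symmetric]) simp
  finally show ?thesis .
qed

text \<open>Lebesgue measure is determined by its values on boxes. The preimage of a box is a box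
  with the same side lengths in another order, so the product of the sides does not change.\<close>

lemma nn_integral_lborel_permute:
  fixes f :: "real^'n \<Rightarrow> ennreal"
  assumes p: "p permutes UNIV" and [measurable]: "f \<in> borel_measurable borel"
  shows "(\<integral>\<^sup>+x. f (\<chi> i. x $ p i) \<partial>lborel) = (\<integral>\<^sup>+x. f x \<partial>lborel)"
proof -
  let ?P = "\<lambda>x::real^'n. \<chi> i. x $ p i"
  have lin: "linear ?P" by (rule linearI) (auto simp: vec_eq_iff)
  have [measurable]: "?P \<in> borel_measurable borel"
    by (rule borel_measurable_continuous_onI) (simp add: lin linear_continuous_on linear_linear)
  have bij: "bij p" using p by (simp add: permutes_bij)
  let ?Q = "\<lambda>x::real^'n. \<chi> i. x $ inv p i"
  have prod_cart: "prod ((\<bullet>) x) Basis = (\<Prod>i\<in>UNIV. x $ i)" for x :: "real^'n"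
  proof -
    have "prod ((\<bullet>) x) Basis = prod ((\<bullet>) x) ((\<lambda>i. axis i 1) ` UNIV)"
      by (rule arg_cong[of _ _ "prod _"]) (auto simp: Basis_vec_def)
    also have "\<dots> = (\<Prod>i\<in>UNIV. x $ i)"
      by (subst prod.reindex) (auto simp: inj_on_def axis_eq_axis inner_axis)
    finally show ?thesis .
  qed
  have "lborel = distr lborel borel ?P"
  proof (rule lborel_eqI)
    fix l u :: "real^'n" assume le: "\<And>b. b \<in> Basis \<Longrightarrow> l \<bullet> b \<le> u \<bullet> b"
    have vim: "?P -` box l u = box (?Q l) (?Q u)"
      using bij by (auto simp: mem_box_cart bij_is_inj bij_is_surj surj_f_inv_f)
         (metis bij bij_inv_eq_iff)+
    have "l $ i \<le> u $ i" for i using le[of "axis i 1"] by (simp add: inner_axis)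
    then have le': "?Q l \<bullet> b \<le> ?Q u \<bullet> b" if "b \<in> Basis" for b
      using that by (auto simp: Basis_vec_def inner_axis)
    have "emeasure (distr lborel borel ?P) (box l u) = emeasure lborel (box (?Q l) (?Q u))"
      by (simp add: emeasure_distr vim)
    also have "\<dots> = ennreal (prod ((\<bullet>) (?Q u - ?Q l)) Basis)"
      using le' by (simp add: emeasure_lborel_box_eq)
    also have "prod ((\<bullet>) (?Q u - ?Q l)) Basis = (\<Prod>i\<in>UNIV. (u - l) $ inv p i)"
      by (simp add: prod_cart)
    also have "\<dots> = (\<Prod>i\<in>UNIV. (u - l) $ i)"
      by (rule prod.reindex_bij_betw) (simp add: bij bij_imp_bij_inv)
    also have "\<dots> = prod ((\<bullet>) (u - l)) Basis" by (simp add: prod_cart)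
    finally show "emeasure (distr lborel borel ?P) (box l u) = ennreal (prod ((\<bullet>) (u - l)) Basis)" .
  qed simp
  then have "(\<integral>\<^sup>+x. f x \<partial>lborel) = (\<integral>\<^sup>+x. f x \<partial>distr lborel borel ?P)" by simp
  then show ?thesis by (simp add: nn_integral_distr)
qed

lemma measurable_matrix_vector_mult [measurable]:
  "(\<lambda>x. A *v x) \<in> borel_measurable (borel :: (real^'n) measure)" for A :: "real^'n^'m"
  by (intro borel_measurable_continuous_onI linear_continuous_on matrix_vector_mul_bounded_linear)

text \<open>The library's linear change of variables needs a well-ordered index type, which
  a product of finite types is not; hence the reduction to elementary matrices here.\<close>
lemma nn_integral_lborel_linear:
  fixes A :: "real^'n^'n" and f :: "real^'n \<Rightarrow> ennreal"
  assumes "det A \<noteq> 0" and "f \<in> borel_measurable borel"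
  shows "(\<integral>\<^sup>+x. f x \<partial>lborel) = ennreal \<bar>det A\<bar> * (\<integral>\<^sup>+x. f (A *v x) \<partial>lborel)"
proof -
  \<comment> \<open>The premise \<open>det A \<noteq> 0\<close> is part of \<open>P\<close>, so a
    matrix with a zero row is a vacuous case. \<open>P\<close> quantifies over all \<open>f\<close>,
    because the product case applies the hypothesis for \<open>B\<close> to
    \<open>\<lambda>x. f (A *v x)\<close>.\<close>
  define P where "P A \<longleftrightarrow> (det A \<noteq> 0 \<longrightarrow> (\<forall>f\<in>borel_measurable borel.
    (\<integral>\<^sup>+x. f x \<partial>lborel) = ennreal \<bar>det A\<bar> * (\<integral>\<^sup>+x. f (A *v x) \<partial>lborel)))" for A :: "real^'n^'n"
  have PD: "(\<integral>\<^sup>+x. f x \<partial>lborel) = ennreal \<bar>det A\<bar> * (\<integral>\<^sup>+x. f (A *v x) \<partial>lborel)"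
    if "P A" "det A \<noteq> 0" "f \<in> borel_measurable borel" for A f
    using that unfolding P_def by blast
  have "P A"
  proof (rule induct_matrix_elementary)
    fix A B assume PA: "P A" and PB: "P B"
    show "P (A ** B)"
      unfolding P_def
    proof (intro impI ballI)
      fix f :: "real^'n \<Rightarrow> ennreal" assume d: "det (A ** B) \<noteq> 0" and [measurable]: "f \<in> borel_measurable borel"
      have nz: "det A \<noteq> 0" "det B \<noteq> 0" using d by (auto simp: det_mul)
      have "(\<integral>\<^sup>+x. f x \<partial>lborel) = ennreal \<bar>det A\<bar> * (\<integral>\<^sup>+x. f (A *v x) \<partial>lborel)"
        by (rule PD[OF PA nz(1)]) measurable
      also have "(\<integral>\<^sup>+x. f (A *v x) \<partial>lborel) = ennreal \<bar>det B\<bar> * (\<integral>\<^sup>+x. f (A *v (B *v x)) \<partial>lborel)"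
        by (rule PD[OF PB nz(2)]) measurable
      finally show "(\<integral>\<^sup>+x. f x \<partial>lborel) = ennreal \<bar>det (A ** B)\<bar> * (\<integral>\<^sup>+x. f ((A ** B) *v x) \<partial>lborel)"
        by (simp add: det_mul abs_mult ennreal_mult mult.assoc matrix_vector_mul_assoc)
    qed
  next
    fix A :: "real^'n^'n" and i assume "row i A = 0"
    then show "P A" by (simp add: P_def det_zero_row)
  next
    fix A :: "real^'n^'n" assume diag: "\<And>i j. i \<noteq> j \<Longrightarrow> A$i$j = 0"
    have det: "det A = (\<Prod>i\<in>UNIV. A $ i $ i)" using diag by (rule det_diagonal)
    have Av: "A *v x = (\<chi> i. A $ i $ i * x $ i)" for x
    proof -
      have "(\<Sum>j\<in>UNIV. A $ i $ j * x $ j) = A $ i $ i * x $ i" for i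
        by (subst sum.remove[of _ i]) (auto intro!: sum.neutral simp: diag)
      then show ?thesis by (simp add: matrix_vector_mult_def)
    qed
    \<comment> \<open>\<open>lborel_affine_euclidean\<close> takes scaling factors indexed by basis
      vectors, so the diagonal entries are re-indexed along the axes.\<close>
    define c where "c b = A $ (axis_index b) $ (axis_index b)" for b :: "real^'n"
    have c_axis: "c (axis i 1) = A $ i $ i" for i by (simp add: c_def axis_index_axis)
    have Basis: "Basis = (\<lambda>i. axis i 1 :: real^'n) ` UNIV" by (auto simp: Basis_vec_def)
    have inj: "inj (\<lambda>i. axis i 1 :: real^'n)" by (auto simp: inj_on_def axis_eq_axis)
    show "P A"
      unfolding P_def
    proof (intro impI ballI)
      fix f :: "real^'n \<Rightarrow> ennreal" assume d: "det A \<noteq> 0" and [measurable]: "f \<in> borel_measurable borel"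
      have nz: "A $ i $ i \<noteq> 0" for i using d by (simp add: det)
      then have nzc: "\<And>j. j \<in> Basis \<Longrightarrow> c j \<noteq> 0" by (auto simp: Basis c_axis)
      have map: "(\<Sum>j\<in>Basis. (c j * (x \<bullet> j)) *\<^sub>R j) = A *v x" for x
      proof -
        have "(\<Sum>j\<in>Basis. (c j * (x \<bullet> j)) *\<^sub>R j) = (\<Sum>i\<in>UNIV. (A $ i $ i * x $ i) *\<^sub>R axis i 1)"
          unfolding Basis by (subst sum.reindex[OF inj]) (simp add: c_axis inner_axis)
        moreover have "(\<Sum>i\<in>UNIV. (A $ i $ i * x $ i) *\<^sub>R axis i 1 :: real^'n) $ k = (A *v x) $ k" for k
        proof -
          have "(\<Sum>i\<in>UNIV. (A $ i $ i * x $ i) *\<^sub>R axis i 1 :: real^'n) $ k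
              = (\<Sum>i\<in>UNIV. if i = k then A $ i $ i * x $ i else 0)"
            unfolding sum_component by (intro sum.cong) (auto simp: axis_def)
          then show ?thesis by (simp add: Av)
        qed
        ultimately show ?thesis by (simp add: vec_eq_iff)
      qed
      have prod: "(\<Prod>j\<in>Basis. \<bar>c j\<bar>) = \<bar>det A\<bar>"
        unfolding Basis by (subst prod.reindex[OF inj]) (simp add: c_axis det abs_prod)
      have "lborel = density (distr lborel borel (\<lambda>x. A *v x)) (\<lambda>_. ennreal \<bar>det A\<bar>)"
        using lborel_affine_euclidean[of c 0] nzc by (simp add: map prod)
      then have "(\<integral>\<^sup>+x. f x \<partial>lborel) = (\<integral>\<^sup>+x. f x \<partial>density (distr lborel borel (\<lambda>x. A *v x)) (\<lambda>_. ennreal \<bar>det A\<bar>))"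
        by (rule arg_cong)
      then show "(\<integral>\<^sup>+x. f x \<partial>lborel) = ennreal \<bar>det A\<bar> * (\<integral>\<^sup>+x. f (A *v x) \<partial>lborel)"
        by (simp add: nn_integral_density nn_integral_distr nn_integral_cmult)
    qed
  next
    fix m n :: 'n assume "m \<noteq> n"
    let ?t = "Transposition.transpose m n"
    let ?A = "(\<chi> i j. mat 1 $ i $ ?t j) :: real^'n^'n"
    have perm: "?t permutes UNIV" by (rule permutes_swap_id) auto
    have det: "\<bar>det ?A\<bar> = 1" using det_permute_columns[OF perm, of "mat 1 :: real^'n^'n"] by (auto simp: sign_def split: if_splits)
    have Av: "?A *v x = (\<chi> i. x $ ?t i)" for x
    proof -
      have "(\<Sum>j\<in>UNIV. mat 1 $ i $ ?t j * x $ j) = x $ ?t i" for i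
        by (subst sum.remove[of _ "?t i"]) (auto intro!: sum.neutral simp: mat_def split: if_splits)
      then show ?thesis by (simp add: matrix_vector_mult_def)
    qed
    show "P ?A"
      unfolding P_def det Av by (auto simp: nn_integral_lborel_permute[OF perm])
  next
    fix m n :: 'n and c :: real assume mn: "m \<noteq> n"
    let ?A = "(\<chi> i j. if i = m \<and> j = n then c else of_bool (i = j)) :: real^'n^'n"
    have "?A = (\<chi> k. if k = m then row m (mat 1) + c *s row n (mat 1) else row k (mat 1))"
      using mn by (auto simp: vec_eq_iff row_def mat_def)
    then have det: "det ?A = 1" using det_row_operation[OF mn, of "mat 1 :: real^'n^'n" c] by simp
    have Av: "?A *v x = x + (c * x $ n) *\<^sub>R axis m 1" for x
    proof -
      have "(\<Sum>j\<in>UNIV. (if i = m \<and> j = n then c else of_bool (i = j)) * x $ j)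
          = x $ i + (if i = m then c * x $ n else 0)" for i
      proof -
        have "(\<Sum>j\<in>UNIV. (if i = m \<and> j = n then c else of_bool (i = j)) * x $ j)
           = (\<Sum>j\<in>UNIV. (if j = i then x $ j else 0) + (if j = n then (if i = m then c * x $ n else 0) else 0))"
          using mn by (intro sum.cong) auto
        also have "\<dots> = x $ i + (if i = m then c * x $ n else 0)"
          by (simp add: sum.distrib)
        finally show ?thesis .
      qed
      then show ?thesis by (simp add: matrix_vector_mult_def vec_eq_iff axis_def)
    qed
    have [measurable]: "(\<lambda>x::real^'n. c * x $ n) \<in> borel_measurable borel"
      by (intro borel_measurable_continuous_onI continuous_intros)
    show "P ?A"
      unfolding P_def det
    proof (intro impI ballI)
      fix f :: "real^'n \<Rightarrow> ennreal" assume [measurable]: "f \<in> borel_measurable borel"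
      \<comment> \<open>Adding a multiple of coordinate \<open>n\<close> to coordinate
        \<open>m\<close> is a shear along \<open>axis m 1\<close>. The shift depends on coordinate
        \<open>n\<close> only, and \<open>m \<noteq> n\<close> keeps it constant along that
        axis.\<close>
      have "(\<integral>\<^sup>+x. f (x + (c * x $ n) *\<^sub>R axis m 1) \<partial>lborel) = (\<integral>\<^sup>+x. f x \<partial>lborel)"
        by (rule nn_integral_lborel_shear) (use mn in \<open>simp_all, simp add: axis_def\<close>)
      then show "(\<integral>\<^sup>+x. f x \<partial>lborel) = ennreal \<bar>1\<bar> * (\<integral>\<^sup>+x. f (?A *v x) \<partial>lborel)"
        by (simp add: Av)
    qed
  qed
  then show ?thesis using assms by (rule PD)
qed

section \<open>Gaussian integrals and the multivariate normal density\<close>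

text \<open>The integrand factors over the coordinates, and each factor is
  \<open>sqrt (2 * pi)\<close> times the standard normal density.\<close>

lemma nn_integral_exp_neg_norm:
  "(\<integral>\<^sup>+x. ennreal (exp (- (x \<bullet> x) / 2)) \<partial>(lborel :: 'a::euclidean_space measure)) = ennreal (sqrt ((2 * pi) ^ DIM('a)))"
proof -
  have one: "(\<integral>\<^sup>+y. ennreal (exp (- y\<^sup>2 / 2)) \<partial>lborel) = ennreal (sqrt (2 * pi))"
  proof -
    have eq: "exp (- y\<^sup>2 / 2) = sqrt (2 * pi) * std_normal_density y" for y
      by (simp add: normal_density_def)
    have "(\<integral>\<^sup>+y. ennreal (std_normal_density y) \<partial>lborel) = 1"
      using prob_space.emeasure_space_1[OF prob_space_normal_density[of 1 0]]
      by (simp add: emeasure_density)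
    then show ?thesis
      unfolding eq by (simp add: ennreal_mult nn_integral_cmult)
  qed
  have "ennreal (exp (- (x \<bullet> x) / 2)) = (\<Prod>b\<in>Basis. ennreal (exp (- (x \<bullet> b)\<^sup>2 / 2)))" for x :: 'a
  proof -
    have "x \<bullet> x = (\<Sum>b\<in>Basis. (x \<bullet> b)\<^sup>2)"
      by (subst euclidean_inner) (simp add: power2_eq_square)
    then have "exp (- (x \<bullet> x) / 2) = (\<Prod>b\<in>Basis. exp (- (x \<bullet> b)\<^sup>2 / 2))"
      by (simp add: exp_sum[symmetric] sum_negf sum_divide_distrib)
    then show ?thesis by (simp add: prod_ennreal)
  qed
  then have "(\<integral>\<^sup>+x. ennreal (exp (- (x \<bullet> x) / 2)) \<partial>(lborel :: 'a measure)) = ennreal (sqrt (2 * pi)) ^ DIM('a)"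
    using nn_integral_lborel_prod[of "\<lambda>_::'a. \<lambda>y. ennreal (exp (- y\<^sup>2 / 2))"] by (simp add: one[simplified])
  then show ?thesis by (subst real_sqrt_power, subst ennreal_power[symmetric]) simp_all
qed

lemma inner_matrix_vector_sym:
  fixes A :: "real^'n^'n"
  assumes "transpose A = A"
  shows "x \<bullet> (A *v y) = y \<bullet> (A *v x)"
  using assms by (metis dot_lmul_matrix inner_commute transpose_matrix_vector)

text \<open>Gram-Schmidt for the inner product given by \<open>A\<close>. Fewer than
  \<open>CARD('n)\<close> vectors \<open>A *v f j\<close> span a proper subspace, so some
  \<open>v \<noteq> 0\<close> is orthogonal to all of them in the Euclidean sense, hence
  \<open>A\<close>-orthogonal to every \<open>f j\<close>; dividing by its \<open>A\<close>-norm
  gives the next vector.\<close>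

lemma pos_def_orthonormal_family:
  fixes A :: "real^'n^'n"
  assumes sym: "transpose A = A" and pd: "\<And>x. x \<noteq> 0 \<Longrightarrow> 0 < x \<bullet> (A *v x)"
  shows "k \<le> CARD('n) \<Longrightarrow> \<exists>f :: nat \<Rightarrow> real^'n. \<forall>i<k. \<forall>j<k. f i \<bullet> (A *v f j) = of_bool (i = j)"
proof (induction k)
  case (Suc k)
  then obtain f :: "nat \<Rightarrow> real^'n" where f: "\<And>i j. i < k \<Longrightarrow> j < k \<Longrightarrow> f i \<bullet> (A *v f j) = of_bool (i = j)"
    by auto
  let ?S = "(\<lambda>j. A *v f j) ` {..<k}"
  have "dim ?S \<le> card ?S" by (rule dim_le_card') simp
  also have "\<dots> \<le> k" using card_image_le[of "{..<k}" "\<lambda>j. A *v f j"] by simp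
  finally have "dim ?S < DIM(real^'n)" using Suc.prems by simp
  then obtain v where v: "v \<noteq> 0" and orth: "\<And>y. y \<in> span ?S \<Longrightarrow> orthogonal v y"
    by (rule orthogonal_to_subspace_exists) blast
  have vf: "v \<bullet> (A *v f j) = 0" if "j < k" for j
    using orth[of "A *v f j"] that by (auto simp: orthogonal_def intro: span_base)
  then have fv: "f j \<bullet> (A *v v) = 0" if "j < k" for j
    using that inner_matrix_vector_sym[OF sym, of "f j" v] by simp
  define c where "c = sqrt (v \<bullet> (A *v v))"
  have c: "c > 0" "c * c = v \<bullet> (A *v v)" using pd[OF v] by (auto simp: c_def)
  define w where "w = (1 / c) *\<^sub>R v"
  have w: "w \<bullet> (A *v w) = 1" "\<And>j. j < k \<Longrightarrow> w \<bullet> (A *v f j) = 0" "\<And>j. j < k \<Longrightarrow> f j \<bullet> (A *v w) = 0"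
    using c by (auto simp: w_def matrix_vector_mult_scaleR vf fv field_simps)
  show ?case
  proof (intro exI[of _ "f(k := w)"] allI impI)
    fix i j assume "i < Suc k" "j < Suc k"
    then show "(f(k := w)) i \<bullet> (A *v (f(k := w)) j) = of_bool (i = j)"
      using f w by (auto simp: less_Suc_eq)
  qed
qed simp

text \<open>The columns of \<open>B\<close> are an \<open>A\<close>-orthonormal basis, so the
  entries of the triple product are the values of the form on pairs of basis vectors.\<close>

lemma pos_def_congruent_identity:
  fixes A :: "real^'n^'n"
  assumes sym: "transpose A = A" and pd: "\<And>x. x \<noteq> 0 \<Longrightarrow> 0 < x \<bullet> (A *v x)"
  obtains B :: "real^'n^'n" where "transpose B ** A ** B = mat 1"
proof -
  obtain f :: "nat \<Rightarrow> real^'n" where f: "\<And>i j. i < CARD('n) \<Longrightarrow> j < CARD('n) \<Longrightarrow> f i \<bullet> (A *v f j) = of_bool (i = j)"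
    using pos_def_orthonormal_family[OF sym pd order_refl] by blast
  obtain e :: "'n \<Rightarrow> nat" where e: "bij_betw e UNIV {..<CARD('n)}"
    using ex_bij_betw_finite_nat[of "UNIV :: 'n set"] by (auto simp: atLeast0LessThan)
  then have e_less: "e i < CARD('n)" and e_eq: "e i = e j \<longleftrightarrow> i = j" for i j
    by (auto simp: bij_betw_def inj_on_def)
  define B :: "real^'n^'n" where "B = (\<chi> a i. f (e i) $ a)"
  have "(transpose B ** A ** B) $ i $ j = f (e i) \<bullet> (A *v f (e j))" for i j
    by (simp add: B_def matrix_matrix_mult_def transpose_def inner_vec_def matrix_vector_mult_def
        sum_distrib_left sum_distrib_right mult.assoc) (subst sum.swap, simp add: mult.assoc)
  then have "transpose B ** A ** B = mat 1"
    by (simp add: vec_eq_iff mat_def f e_less e_eq)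
  then show ?thesis by (rule that)
qed

lemma nn_integral_lborel_translate:
  fixes f :: "'a::euclidean_space \<Rightarrow> ennreal"
  assumes [measurable]: "f \<in> borel_measurable borel"
  shows "(\<integral>\<^sup>+x. f (x - m) \<partial>lborel) = (\<integral>\<^sup>+x. f x \<partial>lborel)"
proof -
  have "(\<integral>\<^sup>+x. f x \<partial>lborel) = (\<integral>\<^sup>+x. f x \<partial>distr lborel borel ((+) (- m)))"
    by (simp add: lborel_distr_plus)
  then show ?thesis by (simp add: nn_integral_distr)
qed

text \<open>The substitution \<open>x = B *v u\<close>, with \<open>B\<close> from the congruence,
  turns the form into \<open>u \<bullet> u\<close>. Taking determinants gives
  \<open>(det B)\<^sup>2 * det A = 1\<close>, which yields both the sign of \<open>det A\<close> and
  the Jacobian \<open>1 / sqrt (det A)\<close>.\<close>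

lemma
  fixes A :: "real^'n^'n"
  assumes sym: "transpose A = A" and pd: "\<And>x. x \<noteq> 0 \<Longrightarrow> 0 < x \<bullet> (A *v x)"
  shows pos_def_det_pos: "det A > 0"
    and nn_integral_gaussian: "(\<integral>\<^sup>+x. ennreal (exp (- ((x - m) \<bullet> (A *v (x - m))) / 2)) \<partial>lborel)
            = ennreal (sqrt ((2 * pi) ^ CARD('n) / det A))"
proof -
  obtain B :: "real^'n^'n" where B: "transpose B ** A ** B = mat 1"
    using pos_def_congruent_identity[OF sym pd] by blast
  have detB: "(det B)\<^sup>2 * det A = 1"
    using arg_cong[OF B, of det] by (simp add: det_mul power2_eq_square mult_ac)
  then show det: "det A > 0" by (metis mult_zero_right not_less not_one_le_zero zero_le_power2 mult_nonneg_nonpos linear order_le_less)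
  have B0: "det B \<noteq> 0" using detB by auto
  have absB: "\<bar>det B\<bar> = 1 / sqrt (det A)"
    using detB det by (metis abs_of_pos mult_eq_0_iff nonzero_eq_divide_eq order_less_irrefl
        real_sqrt_abs real_sqrt_mult real_sqrt_one real_sqrt_eq_0_iff)
  have quad: "(B *v u) \<bullet> (A *v (B *v u)) = u \<bullet> u" for u
  proof -
    have "(B *v u) \<bullet> (A *v (B *v u)) = u \<bullet> ((transpose B ** A ** B) *v u)"
      by (metis dot_lmul_matrix matrix_vector_mul_assoc transpose_matrix_vector transpose_transpose)
    then show ?thesis by (simp add: B)
  qed
  have meas: "(\<lambda>x. ennreal (exp (- (x \<bullet> (A *v x)) / 2))) \<in> borel_measurable borel" by measurable
  have "(\<integral>\<^sup>+x. ennreal (exp (- ((x - m) \<bullet> (A *v (x - m))) / 2)) \<partial>lborel)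
      = (\<integral>\<^sup>+x. ennreal (exp (- (x \<bullet> (A *v x)) / 2)) \<partial>lborel)"
    by (rule nn_integral_lborel_translate[OF meas])
  also have "\<dots> = ennreal \<bar>det B\<bar> * (\<integral>\<^sup>+x. ennreal (exp (- (x \<bullet> x) / 2)) \<partial>(lborel::(real^'n) measure))"
    using nn_integral_lborel_linear[OF B0 meas] by (simp only: quad)
  also have "\<dots> = ennreal (sqrt ((2 * pi) ^ CARD('n) / det A))"
    by (subst nn_integral_exp_neg_norm) (simp add: absB ennreal_mult''[symmetric] real_sqrt_divide)
  finally show "(\<integral>\<^sup>+x. ennreal (exp (- ((x - m) \<bullet> (A *v (x - m))) / 2)) \<partial>lborel)
            = ennreal (sqrt ((2 * pi) ^ CARD('n) / det A))" .
qed

lemma matrix_inv_eqI: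
  fixes A B :: "real^'n^'n"
  assumes "A ** B = mat 1"
  shows "matrix_inv A = B"
proof -
  have BA: "B ** A = mat 1" using assms by (simp add: matrix_left_right_inverse)
  then have "A ** matrix_inv A = mat 1"
    unfolding matrix_inv_def using assms by (metis (mono_tags, lifting) someI_ex)
  then have "B ** (A ** matrix_inv A) = B" by simp
  then show ?thesis by (simp add: matrix_mul_assoc BA)
qed

lemma det_scaleR:
  fixes A :: "real^'n^'n"
  shows "det (c *\<^sub>R A) = c ^ CARD('n) * det A"
proof -
  have "c *\<^sub>R A = (c *\<^sub>R mat 1) ** A"
    by (simp add: scalar_matrix_assoc[symmetric])
  moreover have "det (c *\<^sub>R mat 1 :: real^'n^'n) = c ^ CARD('n)"
    by (subst det_diagonal) (auto simp: mat_def)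
  ultimately show ?thesis by (simp add: det_mul)
qed

lemma pos_def_invertible:
  fixes A :: "real^'n^'n"
  assumes "transpose A = A" and "\<And>x. x \<noteq> 0 \<Longrightarrow> 0 < x \<bullet> (A *v x)"
  shows "A ** matrix_inv A = mat 1" "matrix_inv A ** A = mat 1"
proof -
  have "det A \<noteq> 0" using pos_def_det_pos[OF assms] by simp
  then have "\<exists>B. A ** B = mat 1 \<and> B ** A = mat 1"
    by (simp add: invertible_det_nz[symmetric] invertible_def)
  from someI_ex[OF this] show "A ** matrix_inv A = mat 1" "matrix_inv A ** A = mat 1"
    unfolding matrix_inv_def by auto
qed

text \<open>Passes from the covariance, in which \<open>mvn\<close> is parametrised, to the
  precision \<open>A\<close>, in which the likelihood is a quadratic form.\<close>

lemma mvn_density_matrix_inv: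
  fixes A :: "real^'n^'n"
  assumes "transpose A = A" and "\<And>x. x \<noteq> 0 \<Longrightarrow> 0 < x \<bullet> (A *v x)"
  shows "mvn_density m (matrix_inv A) b
    = exp (- ((b - m) \<bullet> (A *v (b - m))) / 2) / sqrt ((2 * pi) ^ CARD('n) / det A)"
proof -
  have "det A * det (matrix_inv A) = 1"
    using arg_cong[OF pos_def_invertible(1)[OF assms], of det] by (simp add: det_mul)
  then have "det (matrix_inv A) = 1 / det A"
    by (metis mult_zero_left nonzero_mult_div_cancel_left zero_neq_one)
  then show ?thesis
    using matrix_inv_eqI[OF pos_def_invertible(2)[OF assms]] by (simp add: mvn_density_def)
qed

lemma measurable_mvn_density [measurable]: "mvn_density m S \<in> borel_measurable borel"
  unfolding mvn_density_def by measurable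

lemma nn_integral_mvn_density:
  fixes A :: "real^'n^'n"
  assumes "transpose A = A" and "\<And>x. x \<noteq> 0 \<Longrightarrow> 0 < x \<bullet> (A *v x)"
  shows "(\<integral>\<^sup>+b. ennreal (mvn_density m (matrix_inv A) b) \<partial>lborel) = 1"
proof -
  let ?C = "sqrt ((2 * pi) ^ CARD('n) / det A)"
  have C: "?C > 0" using pos_def_det_pos[OF assms] by (simp add: field_simps)
  have "(\<integral>\<^sup>+b. ennreal (mvn_density m (matrix_inv A) b) \<partial>lborel)
     = (\<integral>\<^sup>+b. ennreal (1 / ?C) * ennreal (exp (- ((b - m) \<bullet> (A *v (b - m))) / 2)) \<partial>lborel)"
    using C by (intro nn_integral_cong) (simp add: mvn_density_matrix_inv[OF assms] ennreal_mult''[symmetric])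
  also have "\<dots> = ennreal (1 / ?C) * ennreal ?C"
    by (subst nn_integral_cmult, measurable) (subst nn_integral_gaussian[OF assms], simp_all)
  also have "\<dots> = ennreal (1 / ?C * ?C)" using C by (intro ennreal_mult''[symmetric]) simp
  also have "1 / ?C * ?C = 1" using C by (metis less_irrefl nonzero_eq_divide_eq)
  finally show ?thesis by simp
qed

text \<open>Half of the exponent pays for the tail factor; what remains is a Gaussian whose precision is halved.\<close>
lemma mvn_density_tail:
  fixes A :: "real^'n^'n"
  assumes sym: "transpose A = A" and lam: "\<And>x. lam * (norm x)\<^sup>2 \<le> x \<bullet> (A *v x)" "lam > 0" and r: "r > 0"
  shows "(\<integral>\<^sup>+b. ennreal (indicator {b. r < norm (b - m)} b * mvn_density m (matrix_inv A) b) \<partial>lborel)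
    \<le> ennreal (exp (- lam * r\<^sup>2 / 4) * sqrt (2 ^ CARD('n)))"
proof -
  have pd: "0 < x \<bullet> (A *v x)" if "x \<noteq> 0" for x
    by (rule less_le_trans[OF _ lam(1)]) (use lam(2) that in simp)
  let ?H = "(1/2) *\<^sub>R A"
  have symH: "transpose ?H = ?H" using sym by (simp add: transpose_scalar)
  have quadH: "x \<bullet> (?H *v x) = (x \<bullet> (A *v x)) / 2" for x
    by (simp add: scaleR_matrix_vector_assoc[symmetric])
  have pdH: "0 < x \<bullet> (?H *v x)" if "x \<noteq> 0" for x using pd[OF that] by (simp add: quadH)
  let ?C = "sqrt ((2 * pi) ^ CARD('n) / det A)" and ?e = "exp (- lam * r\<^sup>2 / 4)"
  have detA: "det A > 0" by (rule pos_def_det_pos[OF sym pd])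
  have C: "?C > 0" using detA by (simp add: field_simps)
  have "(\<integral>\<^sup>+b. ennreal (indicator {b. r < norm (b - m)} b * mvn_density m (matrix_inv A) b) \<partial>lborel)
     \<le> (\<integral>\<^sup>+b. ennreal (?e / ?C) * ennreal (exp (- ((b - m) \<bullet> (?H *v (b - m))) / 2)) \<partial>lborel)"
  proof (rule nn_integral_mono)
    fix b
    let ?q = "(b - m) \<bullet> (A *v (b - m))"
    have "indicator {b. r < norm (b - m)} b * exp (- ?q / 2) \<le> ?e * exp (- ?q / 4)"
    proof (cases "r < norm (b - m)")
      case True
      then have "lam * r\<^sup>2 \<le> lam * (norm (b - m))\<^sup>2" using r lam(2) by (intro mult_left_mono power_mono) auto
      also have "\<dots> \<le> ?q" by (rule lam)
      finally have "exp (- ?q / 2) \<le> exp (- lam * r\<^sup>2 / 4 + - ?q / 4)" by simp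
      then show ?thesis using True by (simp add: exp_add[symmetric])
    qed simp
    then have "indicator {b. r < norm (b - m)} b * exp (- ?q / 2) / ?C \<le> ?e * exp (- ?q / 4) / ?C"
      using C by (intro divide_right_mono) auto
    then show "ennreal (indicator {b. r < norm (b - m)} b * mvn_density m (matrix_inv A) b)
       \<le> ennreal (?e / ?C) * ennreal (exp (- ((b - m) \<bullet> (?H *v (b - m))) / 2))"
      using mvn_density_matrix_inv[OF sym pd, of m b] unfolding quadH
      by (subst ennreal_mult''[symmetric]) (auto intro!: ennreal_leI)
  qed
  also have "\<dots> = ennreal (?e / ?C) * ennreal (sqrt ((2 * pi) ^ CARD('n) / det ?H))"
    by (subst nn_integral_cmult, measurable) (subst nn_integral_gaussian[OF symH pdH], simp_all)
  also have "\<dots> = ennreal (?e / ?C * sqrt ((2 * pi) ^ CARD('n) / det ?H))"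
    using pos_def_det_pos[OF symH pdH] by (intro ennreal_mult''[symmetric]) simp
  also have "?e / ?C * sqrt ((2 * pi) ^ CARD('n) / det ?H) = ?e * sqrt (2 ^ CARD('n))"
  proof -
    \<comment> \<open>Halving the precision divides the determinant by \<open>2 ^ CARD('n)\<close>;
      this is the origin of the factor \<open>sqrt (2 ^ CARD('n))\<close> in the bound.\<close>
    have "(2 * pi) ^ CARD('n) / det ?H = 2 ^ CARD('n) * ((2 * pi) ^ CARD('n) / det A)"
      by (simp add: det_scaleR power_one_over field_simps)
    then have "sqrt ((2 * pi) ^ CARD('n) / det ?H) = sqrt (2 ^ CARD('n)) * ?C"
      by (simp only: real_sqrt_mult)
    then show ?thesis using C detA by (simp only:) simp
  qed
  finally show ?thesis .
qed

section \<open>Extreme eigenvalues of symmetric matrices\<close>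

text \<open>The form attains its minimum on the compact unit sphere, and homogeneity extends the
  bound to every \<open>x\<close>. The minimiser is an eigenvector, so the optimal constant is
  itself an eigenvalue.\<close>

lemma matrix_attains_rayleigh_min:
  fixes A :: "real^'n^'n"
  assumes sym: "transpose A = A"
  obtains v c where "v \<noteq> 0" "A *v v = c *\<^sub>R v" "\<And>x. c * (norm x)\<^sup>2 \<le> x \<bullet> (A *v x)"
proof -
  let ?q = "\<lambda>x. x \<bullet> (A *v x)"
  have cont: "continuous_on S ?q" for S
    by (intro continuous_intros linear_continuous_on matrix_vector_mul_bounded_linear)
  have "axis undefined 1 \<in> sphere (0::real^'n) 1" by (simp add: norm_axis_1)
  then obtain v where v: "v \<in> sphere 0 1" and vmin: "\<And>y. y \<in> sphere 0 1 \<Longrightarrow> ?q v \<le> ?q y"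
    using continuous_attains_inf[OF compact_sphere _ cont, of "0::real^'n" 1] by blast
  define c where "c = ?q v"
  have nv: "norm v = 1" using v by simp
  have ray: "c * (norm x)\<^sup>2 \<le> ?q x" for x
  proof (cases "x = 0")
    case False
    then have "c \<le> ?q ((1 / norm x) *\<^sub>R x)" unfolding c_def by (intro vmin) simp
    also have "\<dots> = ?q x / (norm x)\<^sup>2"
      by (simp add: matrix_vector_mult_scaleR power2_eq_square)
    finally show ?thesis using False by (simp add: field_simps)
  qed simp
  text \<open>The form \<open>x \<bullet> A x - c |x|\<^sup>2\<close> is nonnegative and vanishes at \<open>v\<close>, so its gradient there vanishes.\<close>
  define w where "w = A *v v - c *\<^sub>R v"
  have quad: "0 \<le> 2 * t * (norm w)\<^sup>2 + t\<^sup>2 * (?q w - c * (norm w)\<^sup>2)" for t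
  proof -
    have "A *v (v + t *\<^sub>R w) = A *v v + t *\<^sub>R (A *v w)"
      by (simp add: matrix_vector_right_distrib matrix_vector_mult_scaleR)
    then have "?q (v + t *\<^sub>R w) = ?q v + 2 * t * (w \<bullet> (A *v v)) + t\<^sup>2 * ?q w"
      using inner_matrix_vector_sym[OF sym, of v w]
      by (simp add: inner_simps power2_eq_square algebra_simps)
    moreover have "(norm (v + t *\<^sub>R w))\<^sup>2 = 1 + 2 * t * (w \<bullet> v) + t\<^sup>2 * (norm w)\<^sup>2"
    proof -
      have "v \<bullet> v = 1" using nv by (simp add: dot_square_norm)
      then show ?thesis
        unfolding power2_norm_eq_inner by (simp add: inner_simps inner_commute power2_eq_square algebra_simps)
    qed
    ultimately have "c * (1 + 2 * t * (w \<bullet> v) + t\<^sup>2 * (norm w)\<^sup>2) \<le> c + 2 * t * (w \<bullet> (A *v v)) + t\<^sup>2 * ?q w"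
      using ray[of "v + t *\<^sub>R w"] by (simp only: c_def)
    moreover have "(norm w)\<^sup>2 = w \<bullet> (A *v v) - c * (w \<bullet> v)"
      by (simp add: power2_norm_eq_inner w_def inner_simps)
    then have "2 * t * (norm w)\<^sup>2 = 2 * t * (w \<bullet> (A *v v)) - 2 * t * c * (w \<bullet> v)"
      by (simp only: right_diff_distrib mult.assoc)
    ultimately show ?thesis by (simp add: algebra_simps)
  qed
  have "w = 0"
  proof (rule ccontr)
    assume "w \<noteq> 0"
    define a where "a = (norm w)\<^sup>2"
    define b where "b = ?q w - c * a"
    have a: "a > 0" using \<open>w \<noteq> 0\<close> by (simp add: a_def)
    have b: "b \<ge> 0" using ray[of w] by (simp add: b_def a_def)
    \<comment> \<open>A small negative step along \<open>w\<close>. It makes the supposedly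
      nonnegative expression equal to \<open>t * (a - t) < 0\<close>; the \<open>+ 1\<close> keeps
      the denominator positive when \<open>b = 0\<close>.\<close>
    define t where "t = - a / (b + 1)"
    have t: "t < 0" "t * (b + 1) = - a" using a b by (auto simp: t_def field_simps)
    have "0 \<le> 2 * t * a + t\<^sup>2 * b" using quad[of t] by (simp only: a_def b_def)
    then have "0 \<le> t * (2 * a + t * b)" by (simp add: power2_eq_square algebra_simps)
    moreover have "2 * a + t * b = a - t" using t(2) by (simp add: algebra_simps)
    ultimately show False using t(1) a mult_neg_pos[of t "a - t"] by simp
  qed
  then have "A *v v = c *\<^sub>R v" by (simp add: w_def)
  moreover have "v \<noteq> 0" using nv by auto
  ultimately show ?thesis using ray that by blast
qed

text \<open>Eigenvectors of a symmetric matrix for distinct eigenvalues are orthogonal, hence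
  independent, so there are finitely many. This gives \<open>Min\<close> and \<open>Max\<close> in
  \<open>lambda_min\<close> and \<open>lambda_max\<close> their usual properties.\<close>

lemma finite_eigenvalues:
  fixes A :: "real^'n^'n"
  assumes sym: "transpose A = A"
  shows "finite (eigenvalues A)"
proof -
  have "\<forall>c\<in>eigenvalues A. \<exists>v. v \<noteq> 0 \<and> A *v v = c *\<^sub>R v" by (auto simp: eigenvalues_def)
  then obtain f where f: "\<And>c. c \<in> eigenvalues A \<Longrightarrow> f c \<noteq> 0" "\<And>c. c \<in> eigenvalues A \<Longrightarrow> A *v f c = c *\<^sub>R f c"
    by metis
  have orth: "f c \<bullet> f d = 0" if "c \<in> eigenvalues A" "d \<in> eigenvalues A" "c \<noteq> d" for c d
  proof -
    have "c * (f c \<bullet> f d) = d * (f c \<bullet> f d)"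
      using inner_matrix_vector_sym[OF sym, of "f d" "f c"] that by (simp add: f inner_commute)
    then show ?thesis using that by simp
  qed
  have inj: "inj_on f (eigenvalues A)"
  proof (rule inj_onI, rule ccontr)
    fix c d assume cd: "c \<in> eigenvalues A" "d \<in> eigenvalues A" "f c = f d" "c \<noteq> d"
    then show False using orth[of c d] f(1)[of d] by simp
  qed
  have "pairwise orthogonal (f ` eigenvalues A)"
    by (auto simp: pairwise_def orthogonal_def intro!: orth)
  moreover have "0 \<notin> f ` eigenvalues A" using f(1) by auto
  ultimately have "independent (f ` eigenvalues A)" by (rule pairwise_orthogonal_independent)
  then have "finite (f ` eigenvalues A)" by (rule independent_imp_finite)
  then show ?thesis using inj by (simp add: finite_image_iff)
qed

text \<open>The Rayleigh minimum is an eigenvalue, so the least eigenvalue lies below it.\<close>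

lemma lambda_min_le_form:
  fixes A :: "real^'n^'n"
  assumes sym: "transpose A = A"
  shows "lambda_min A * (norm x)\<^sup>2 \<le> x \<bullet> (A *v x)"
proof -
  obtain v c where v: "v \<noteq> 0" "A *v v = c *\<^sub>R v" and ray: "\<And>x. c * (norm x)\<^sup>2 \<le> x \<bullet> (A *v x)"
    using matrix_attains_rayleigh_min[OF sym] by blast
  have "lambda_min A \<le> c"
    unfolding lambda_min_def using v by (intro Min_le finite_eigenvalues sym) (auto simp: eigenvalues_def)
  then have "lambda_min A * (norm x)\<^sup>2 \<le> c * (norm x)\<^sup>2" by (intro mult_right_mono) auto
  then show ?thesis using ray[of x] by simp
qed

text \<open>The Rayleigh minimum of \<open>- A\<close>, with the sign reversed, is an eigenvalue of
  \<open>A\<close>.\<close>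

lemma form_le_lambda_max:
  fixes A :: "real^'n^'n"
  assumes sym: "transpose A = A"
  shows "x \<bullet> (A *v x) \<le> lambda_max A * (norm x)\<^sup>2"
proof -
  have neg: "(- A) *v y = - (A *v y)" for y
    by (simp add: vec_eq_iff matrix_vector_mult_def sum_negf)
  have "transpose (- A) = - A" using sym by (simp add: transpose_def vec_eq_iff)
  then obtain v c where v: "v \<noteq> 0" "(- A) *v v = c *\<^sub>R v" and ray: "\<And>x. c * (norm x)\<^sup>2 \<le> x \<bullet> ((- A) *v x)"
    using matrix_attains_rayleigh_min[of "- A"] by blast
  have "A *v v = (- c) *\<^sub>R v" using v(2) by (simp add: neg) (metis minus_equation_iff)
  then have "- c \<in> eigenvalues A" using v(1) by (auto simp: eigenvalues_def)
  then have "- c \<le> lambda_max A"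
    unfolding lambda_max_def by (intro Max_ge finite_eigenvalues sym)
  then have "- c * (norm x)\<^sup>2 \<le> lambda_max A * (norm x)\<^sup>2" by (intro mult_right_mono) auto
  then show ?thesis using ray[of x] by (simp add: neg)
qed

lemma lambda_min_le_lambda_max:
  fixes A :: "real^'n^'n"
  assumes sym: "transpose A = A"
  shows "lambda_min A \<le> lambda_max A"
  using lambda_min_le_form[OF sym, of "axis undefined 1"] form_le_lambda_max[OF sym, of "axis undefined 1"]
  by (simp add: norm_axis_1)

section \<open>The law of the history\<close>

lemma measurable_normal_kernel [measurable]:
  fixes beta0 :: "'v::euclidean_space"
  assumes sg: "sg > 0"
  shows "(\<lambda>x. density lborel (normal_density (x \<bullet> beta0) sg)) \<in> borel \<rightarrow>\<^sub>M prob_algebra borel"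
proof (rule measurable_prob_algebraI)
  show "prob_space (density lborel (normal_density (x \<bullet> beta0) sg))" for x
    by (rule prob_space_normal_density[OF sg])
  show "(\<lambda>x. density lborel (normal_density (x \<bullet> beta0) sg)) \<in> borel \<rightarrow>\<^sub>M subprob_algebra borel"
  proof (rule measurable_subprob_algebra)
    show "subprob_space (density lborel (normal_density (x \<bullet> beta0) sg))" for x
      by (intro prob_space_imp_subprob_space prob_space_normal_density sg)
    fix A :: "real set" assume [measurable]: "A \<in> sets borel"
    have "(\<lambda>x. \<integral>\<^sup>+y. ennreal (normal_density (x \<bullet> beta0) sg y) * indicator A y \<partial>lborel) \<in> borel_measurable borel"
      unfolding normal_density_def by measurable
    then show "(\<lambda>x. emeasure (density lborel (normal_density (x \<bullet> beta0) sg)) A) \<in> borel_measurable borel"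
      by (simp add: emeasure_density)
  qed simp
qed

lemma measurable_history_snoc [measurable]:
  "(\<lambda>((h, x), y). h(n := (x, y))) \<in>
    (PiM {..<n} (\<lambda>_. borel) \<Otimes>\<^sub>M borel) \<Otimes>\<^sub>M borel \<rightarrow>\<^sub>M PiM {..<Suc n} (\<lambda>_. (borel :: ('v::euclidean_space \<times> real) measure))"
proof -
  have "(\<lambda>w. (fst (fst w), (snd (fst w), snd w))) \<in>
    (PiM {..<n} (\<lambda>_. borel :: ('v \<times> real) measure) \<Otimes>\<^sub>M borel) \<Otimes>\<^sub>M borel \<rightarrow>\<^sub>M PiM {..<n} (\<lambda>_. borel) \<Otimes>\<^sub>M (borel :: ('v \<times> real) measure)"
    unfolding borel_prod[symmetric] by measurable
  from measurable_compose[OF this measurable_add_dim]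
  show ?thesis by (simp add: lessThan_Suc case_prod_beta')
qed

text \<open>One round of sampling as a Markov kernel. The inner part is measurable jointly in
  \<open>h\<close> and \<open>x\<close>, since \<open>x\<close> is then integrated against
  \<open>Lam n h\<close>, which itself varies with \<open>h\<close>.\<close>

lemma
  fixes Lam :: "nat \<Rightarrow> (nat \<Rightarrow> 'v \<times> real) \<Rightarrow> 'v::euclidean_space measure"
  assumes sg: "sg > 0" and Lam [measurable]: "\<And>j. Lam j \<in> PiM {..<j} (\<lambda>_. borel) \<rightarrow>\<^sub>M prob_algebra borel"
  shows measurable_hist_kernel_inner: "(\<lambda>(h, x). density lborel (normal_density (x \<bullet> beta0) sg) \<bind> (\<lambda>y. return (PiM {..<Suc n} (\<lambda>_. borel)) (h(n := (x, y)))))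
     \<in> PiM {..<n} (\<lambda>_. borel) \<Otimes>\<^sub>M borel \<rightarrow>\<^sub>M prob_algebra (PiM {..<Suc n} (\<lambda>_. borel))"
    and measurable_hist_kernel: "(\<lambda>h. Lam n h \<bind> (\<lambda>x. density lborel (normal_density (x \<bullet> beta0) sg) \<bind> (\<lambda>y. return (PiM {..<Suc n} (\<lambda>_. borel)) (h(n := (x, y))))))
     \<in> PiM {..<n} (\<lambda>_. borel) \<rightarrow>\<^sub>M prob_algebra (PiM {..<Suc n} (\<lambda>_. borel))"
proof -
  note measurable_normal_kernel[OF sg, measurable]
  have [measurable]: "(\<lambda>w. return (PiM {..<Suc n} (\<lambda>_. borel)) ((fst (fst w))(n := (snd (fst w), snd w))))
    \<in> (PiM {..<n} (\<lambda>_. borel) \<Otimes>\<^sub>M borel) \<Otimes>\<^sub>M borel \<rightarrow>\<^sub>M prob_algebra (PiM {..<Suc n} (\<lambda>_. (borel :: ('v \<times> real) measure)))"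
    using measurable_compose[OF measurable_history_snoc measurable_return_prob_space] by (simp add: case_prod_beta')
  show inner: "(\<lambda>(h, x). density lborel (normal_density (x \<bullet> beta0) sg) \<bind> (\<lambda>y. return (PiM {..<Suc n} (\<lambda>_. borel)) (h(n := (x, y)))))
     \<in> PiM {..<n} (\<lambda>_. borel) \<Otimes>\<^sub>M borel \<rightarrow>\<^sub>M prob_algebra (PiM {..<Suc n} (\<lambda>_. borel))"
    unfolding case_prod_beta'
    by (rule measurable_bind_prob_space2[where N = borel]) (simp_all add: case_prod_beta')
  show "(\<lambda>h. Lam n h \<bind> (\<lambda>x. density lborel (normal_density (x \<bullet> beta0) sg) \<bind> (\<lambda>y. return (PiM {..<Suc n} (\<lambda>_. borel)) (h(n := (x, y))))))
     \<in> PiM {..<n} (\<lambda>_. borel) \<rightarrow>\<^sub>M prob_algebra (PiM {..<Suc n} (\<lambda>_. borel))"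
    by (rule measurable_bind_prob_space2[OF Lam inner])
qed

lemma hist_in_prob_algebra:
  fixes Lam :: "nat \<Rightarrow> (nat \<Rightarrow> 'v \<times> real) \<Rightarrow> 'v::euclidean_space measure"
  assumes sg: "sg > 0" and Lam: "\<And>j. Lam j \<in> PiM {..<j} (\<lambda>_. borel) \<rightarrow>\<^sub>M prob_algebra borel"
  shows "hist Lam beta0 sg n \<in> space (prob_algebra (PiM {..<n} (\<lambda>_. borel)))"
proof (induction n)
  case 0
  then show ?case by (simp add: space_prob_algebra prob_space_return space_PiM)
next
  case (Suc n)
  \<comment> \<open>The law of the history is regarded as a constant kernel on \<open>unit\<close>,
    so that the rule for composing kernels applies.\<close>
  have "(\<lambda>_::unit. hist Lam beta0 sg n \<bind> (\<lambda>h. Lam n h \<bind> (\<lambda>x. density lborel (normal_density (x \<bullet> beta0) sg) \<bind> (\<lambda>y. return (PiM {..<Suc n} (\<lambda>_. borel)) (h(n := (x, y)))))))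
     \<in> count_space UNIV \<rightarrow>\<^sub>M prob_algebra (PiM {..<Suc n} (\<lambda>_. borel))"
    by (rule measurable_bind_prob_space[OF _ measurable_hist_kernel[OF sg Lam]])
      (simp add: Suc.IH)
  from measurable_space[OF this, of "()"] show ?case by simp
qed

lemma
  fixes Lam :: "nat \<Rightarrow> (nat \<Rightarrow> 'v \<times> real) \<Rightarrow> 'v::euclidean_space measure"
  assumes sg: "sg > 0" and Lam: "\<And>j. Lam j \<in> PiM {..<j} (\<lambda>_. borel) \<rightarrow>\<^sub>M prob_algebra borel"
  shows prob_space_hist: "prob_space (hist Lam beta0 sg n)"
    and sets_hist: "sets (hist Lam beta0 sg n) = sets (PiM {..<n} (\<lambda>_. borel))"
    and space_hist: "space (hist Lam beta0 sg n) = space (PiM {..<n} (\<lambda>_. borel :: ('v \<times> real) measure))"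
  using hist_in_prob_algebra[OF assms, of beta0 n] by (auto simp: space_prob_algebra dest: sets_eq_imp_space_eq)

text \<open>The tower property: the last round is integrated first, conditionally on the past.
  Expectations over the adaptive process then become accessible to induction on
  \<open>n\<close>.\<close>

lemma nn_integral_hist_Suc:
  fixes Lam :: "nat \<Rightarrow> (nat \<Rightarrow> 'v \<times> real) \<Rightarrow> 'v::euclidean_space measure"
  assumes sg: "sg > 0" and Lam: "\<And>j. Lam j \<in> PiM {..<j} (\<lambda>_. borel) \<rightarrow>\<^sub>M prob_algebra borel"
    and f: "f \<in> borel_measurable (PiM {..<Suc n} (\<lambda>_. borel))"
  shows "(\<integral>\<^sup>+h. f h \<partial>hist Lam beta0 sg (Suc n)) =
    (\<integral>\<^sup>+h. \<integral>\<^sup>+x. \<integral>\<^sup>+y. f (h(n := (x, y))) \<partial>density lborel (normal_density (x \<bullet> beta0) sg) \<partial>Lam n h \<partial>hist Lam beta0 sg n)"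
proof -
  let ?P = "PiM {..<n} (\<lambda>_. borel :: ('v \<times> real) measure)" and ?S = "PiM {..<Suc n} (\<lambda>_. borel :: ('v \<times> real) measure)"
  let ?N = "\<lambda>x. density lborel (normal_density (x \<bullet> beta0) sg)"
  have "(\<integral>\<^sup>+h. f h \<partial>hist Lam beta0 sg (Suc n)) =
     (\<integral>\<^sup>+h. \<integral>\<^sup>+w. f w \<partial>(Lam n h \<bind> (\<lambda>x. ?N x \<bind> (\<lambda>y. return ?S (h(n := (x, y)))))) \<partial>hist Lam beta0 sg n)"
    unfolding hist.simps
    using measurable_hist_kernel[OF sg Lam, where n = n and ?beta0.0 = beta0]
    by (subst nn_integral_bind[OF f])
      (auto intro!: measurable_prob_algebraD simp: measurable_cong_sets[OF sets_hist[OF sg Lam] refl])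
  also have "\<dots> = (\<integral>\<^sup>+h. \<integral>\<^sup>+x. \<integral>\<^sup>+y. f (h(n := (x, y))) \<partial>?N x \<partial>Lam n h \<partial>hist Lam beta0 sg n)"
  proof (rule nn_integral_cong)
    fix h assume "h \<in> space (hist Lam beta0 sg n)"
    then have h: "h \<in> space ?P" by (simp add: space_hist[OF sg Lam])
    have sL: "sets (Lam n h) = sets borel" using measurable_space[OF Lam h] by (simp add: space_prob_algebra)
    have "(\<lambda>x. ?N x \<bind> (\<lambda>y. return ?S (h(n := (x, y))))) \<in> borel \<rightarrow>\<^sub>M prob_algebra ?S"
      using measurable_compose[OF measurable_Pair1'[OF h] measurable_hist_kernel_inner[OF sg Lam, where n = n and ?beta0.0 = beta0]] by simp
    then have k: "(\<lambda>x. ?N x \<bind> (\<lambda>y. return ?S (h(n := (x, y))))) \<in> Lam n h \<rightarrow>\<^sub>M subprob_algebra ?S"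
      by (intro measurable_prob_algebraD) (simp add: measurable_cong_sets[OF sL refl])
    have "(\<integral>\<^sup>+w. f w \<partial>(Lam n h \<bind> (\<lambda>x. ?N x \<bind> (\<lambda>y. return ?S (h(n := (x, y)))))))
       = (\<integral>\<^sup>+x. \<integral>\<^sup>+w. f w \<partial>(?N x \<bind> (\<lambda>y. return ?S (h(n := (x, y))))) \<partial>Lam n h)"
      by (rule nn_integral_bind[OF f k])
    also have "\<dots> = (\<integral>\<^sup>+x. \<integral>\<^sup>+y. f (h(n := (x, y))) \<partial>?N x \<partial>Lam n h)"
    proof (rule nn_integral_cong)
      fix x
      have snoc: "(\<lambda>y. h(n := (x, y))) \<in> borel \<rightarrow>\<^sub>M ?S"
        using measurable_compose[OF measurable_Pair1'[of "(h, x)" "?P \<Otimes>\<^sub>M borel" borel] measurable_history_snoc] h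
        by (simp add: space_pair_measure)
      then have r: "(\<lambda>y. return ?S (h(n := (x, y)))) \<in> ?N x \<rightarrow>\<^sub>M subprob_algebra ?S"
        by (simp add: measurable_compose[OF _ return_measurable] cong: measurable_cong_sets)
      show "(\<integral>\<^sup>+w. f w \<partial>(?N x \<bind> (\<lambda>y. return ?S (h(n := (x, y)))))) = (\<integral>\<^sup>+y. f (h(n := (x, y))) \<partial>?N x)"
        unfolding nn_integral_bind[OF f r]
        using measurable_space[OF snoc] by (intro nn_integral_cong nn_integral_return f) auto
    qed
    finally show "(\<integral>\<^sup>+w. f w \<partial>(Lam n h \<bind> (\<lambda>x. ?N x \<bind> (\<lambda>y. return ?S (h(n := (x, y)))))))
       = (\<integral>\<^sup>+x. \<integral>\<^sup>+y. f (h(n := (x, y))) \<partial>?N x \<partial>Lam n h)" .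
  qed
  finally show ?thesis .
qed

text \<open>Likelihood ratio of \<open>beta0 + b\<close> against the true parameter \<open>beta0\<close>.\<close>
definition lratio :: "'v::euclidean_space \<Rightarrow> real \<Rightarrow> nat \<Rightarrow> 'v \<Rightarrow> (nat \<Rightarrow> 'v \<times> real) \<Rightarrow> real" where
  "lratio beta0 sg n b h =
     (\<Prod>j<n. exp (((b \<bullet> fst (h j)) * (snd (h j) - fst (h j) \<bullet> beta0) - (b \<bullet> fst (h j))\<^sup>2 / 2) / sg\<^sup>2))"

text \<open>Joint measurability in \<open>b\<close> and \<open>h\<close> is what allows the
  integrals over directions and histories to be exchanged later.\<close>

lemma measurable_lratio [measurable]:
  "(\<lambda>(b, h). lratio beta0 sg n b h) \<in> borel_measurable (borel \<Otimes>\<^sub>M PiM {..<n} (\<lambda>_. (borel :: ('v::euclidean_space \<times> real) measure)))"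
proof -
  have [measurable]: "(\<lambda>w. fst (snd w j)) \<in> borel_measurable (borel \<Otimes>\<^sub>M PiM {..<n} (\<lambda>_. (borel :: ('v \<times> real) measure)))"
       "(\<lambda>w. snd (snd w j)) \<in> borel_measurable (borel \<Otimes>\<^sub>M PiM {..<n} (\<lambda>_. (borel :: ('v \<times> real) measure)))"
    if "j < n" for j
  proof -
    have "(\<lambda>w. snd w j) \<in> borel \<Otimes>\<^sub>M PiM {..<n} (\<lambda>_. (borel :: ('v \<times> real) measure)) \<rightarrow>\<^sub>M borel \<Otimes>\<^sub>M borel"
      unfolding borel_prod
      by (rule measurable_compose[OF measurable_snd measurable_component_singleton]) (use that in simp)
    then show "(\<lambda>w. fst (snd w j)) \<in> borel_measurable (borel \<Otimes>\<^sub>M PiM {..<n} (\<lambda>_. (borel :: ('v \<times> real) measure)))"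
       "(\<lambda>w. snd (snd w j)) \<in> borel_measurable (borel \<Otimes>\<^sub>M PiM {..<n} (\<lambda>_. (borel :: ('v \<times> real) measure)))"
      by (auto intro: measurable_compose[OF _ measurable_fst] measurable_compose[OF _ measurable_snd])
  qed
  show ?thesis
    unfolding lratio_def case_prod_beta' by (rule borel_measurable_prod) measurable
qed

text \<open>Completing the square: an exponential tilt of a Gaussian is the same Gaussian with a
  shifted mean.\<close>

lemma normal_density_tilt:
  assumes "sg \<noteq> 0"
  shows "normal_density m sg y * exp ((a * (y - m) - a\<^sup>2 / 2) / sg\<^sup>2) = normal_density (m + a) sg y"
proof -
  have "- (y - m)\<^sup>2 / (2 * sg\<^sup>2) + (a * (y - m) - a\<^sup>2 / 2) / sg\<^sup>2 = - (y - (m + a))\<^sup>2 / (2 * sg\<^sup>2)"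
    using assms by (simp add: field_simps power2_eq_square)
  then show ?thesis
    unfolding normal_density_def mult.assoc exp_add[symmetric] by simp
qed

text \<open>The likelihood ratio is a mean-one martingale. Given the past and \<open>x\<close>, the
  factor of the last round tilts the law of \<open>y\<close> into the normal law of mean
  \<open>x \<bullet> beta0 + b \<bullet> x\<close>, which has total mass 1. This holds for each
  \<open>x\<close>, so the way \<open>Lam\<close> chooses it does not matter.\<close>

lemma nn_integral_lratio:
  fixes Lam :: "nat \<Rightarrow> (nat \<Rightarrow> 'v \<times> real) \<Rightarrow> 'v::euclidean_space measure"
  assumes sg: "sg > 0" and Lam: "\<And>j. Lam j \<in> PiM {..<j} (\<lambda>_. borel) \<rightarrow>\<^sub>M prob_algebra borel"
  shows "(\<integral>\<^sup>+h. ennreal (lratio beta0 sg n b h) \<partial>hist Lam beta0 sg n) = 1"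
proof (induction n)
  case 0
  then show ?case
    using prob_space.emeasure_space_1[OF prob_space_hist[OF sg Lam, of beta0 0]] by (simp add: lratio_def)
next
  case (Suc n)
  have meas: "(\<lambda>h. ennreal (lratio beta0 sg (Suc n) b h)) \<in> borel_measurable (PiM {..<Suc n} (\<lambda>_. borel))"
    using measurable_compose[OF measurable_Pair1'[of b borel] measurable_lratio] by (simp add: measurable_compose)
  have "(\<integral>\<^sup>+x. \<integral>\<^sup>+y. ennreal (lratio beta0 sg (Suc n) b (h(n := (x, y)))) \<partial>density lborel (normal_density (x \<bullet> beta0) sg) \<partial>Lam n h)
      = ennreal (lratio beta0 sg n b h)" if "h \<in> space (hist Lam beta0 sg n)" for h
  proof -
    have h: "h \<in> space (PiM {..<n} (\<lambda>_. borel))" using that by (simp add: space_hist[OF sg Lam])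
    interpret L: prob_space "Lam n h" using measurable_space[OF Lam h] by (simp add: space_prob_algebra)
    have "(\<integral>\<^sup>+y. ennreal (lratio beta0 sg (Suc n) b (h(n := (x, y)))) \<partial>density lborel (normal_density (x \<bullet> beta0) sg))
       = ennreal (lratio beta0 sg n b h)" for x
    proof -
      have "lratio beta0 sg (Suc n) b (h(n := (x, y)))
         = lratio beta0 sg n b h * exp (((b \<bullet> x) * (y - x \<bullet> beta0) - (b \<bullet> x)\<^sup>2 / 2) / sg\<^sup>2)" for y
        by (simp add: lratio_def)
      then have "(\<integral>\<^sup>+y. ennreal (lratio beta0 sg (Suc n) b (h(n := (x, y)))) \<partial>density lborel (normal_density (x \<bullet> beta0) sg))
        = (\<integral>\<^sup>+y. ennreal (lratio beta0 sg n b h) * ennreal (normal_density (x \<bullet> beta0 + b \<bullet> x) sg y) \<partial>lborel)"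
        using sg by (subst nn_integral_density)
         (auto intro!: nn_integral_cong simp: normal_density_tilt[symmetric] ennreal_mult[symmetric]
            ennreal_mult''[symmetric] lratio_def prod_nonneg mult_ac)
      also have "\<dots> = ennreal (lratio beta0 sg n b h) * emeasure (density lborel (normal_density (x \<bullet> beta0 + b \<bullet> x) sg)) UNIV"
        by (subst nn_integral_cmult) (simp_all add: emeasure_density)
      also have "\<dots> = ennreal (lratio beta0 sg n b h)"
        using prob_space.emeasure_space_1[OF prob_space_normal_density[OF sg]] by simp
      finally show ?thesis .
    qed
    then show ?thesis by (simp add: L.emeasure_space_1)
  qed
  then show ?case
    unfolding nn_integral_hist_Suc[OF sg Lam meas] by (simp add: Suc.IH cong: nn_integral_cong)
qed

section \<open>Total variation and quadratic exponentials\<close>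

lemma tv_dist_density_le:
  fixes f g :: "'a::euclidean_space \<Rightarrow> real"
  assumes f: "integrable lborel f" "\<And>x. 0 \<le> f x" and g: "integrable lborel g" "\<And>x. 0 \<le> g x"
  shows "\<bar>tv_dist (density lborel (\<lambda>x. ennreal (f x))) (density lborel (\<lambda>x. ennreal (g x)))\<bar>
    \<le> (\<integral>x. \<bar>f x - g x\<bar> \<partial>lborel)"
proof -
  let ?I = "\<integral>x. \<bar>f x - g x\<bar> \<partial>lborel"
  let ?d = "\<lambda>A. \<bar>measure (density lborel (\<lambda>x. ennreal (f x))) A - measure (density lborel (\<lambda>x. ennreal (g x))) A\<bar>"
  have meas: "measure (density lborel (\<lambda>x. ennreal (k x))) A = (\<integral>x. k x * indicator A x \<partial>lborel)"
    if k: "integrable lborel k" "\<And>x. 0 \<le> k x" and A: "A \<in> sets borel" for k :: "'a \<Rightarrow> real" and A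
  proof -
    have int: "integrable lborel (\<lambda>x. k x * indicator A x)"
      using A k(1) by (intro integrable_real_mult_indicator) simp
    have "emeasure (density lborel (\<lambda>x. ennreal (k x))) A = (\<integral>\<^sup>+x. ennreal (k x * indicator A x) \<partial>lborel)"
      using k A by (subst emeasure_density) (auto intro!: nn_integral_cong simp: indicator_def)
    also have "\<dots> = ennreal (\<integral>x. k x * indicator A x \<partial>lborel)"
      using k(2) by (intro nn_integral_eq_integral int) auto
    finally show ?thesis using k(2) by (simp add: measure_def Bochner_Integration.integral_nonneg)
  qed
  have bound: "?d A \<le> ?I" if A: "A \<in> sets borel" for A
  proof -
    have ints: "integrable lborel (\<lambda>x. f x * indicator A x)" "integrable lborel (\<lambda>x. g x * indicator A x)"
      using A f(1) g(1) by (auto intro!: integrable_real_mult_indicator)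
    have "?d A = \<bar>\<integral>x. f x * indicator A x - g x * indicator A x \<partial>lborel\<bar>"
      using f g A ints by (simp add: meas)
    also have "\<dots> \<le> (\<integral>x. \<bar>f x * indicator A x - g x * indicator A x\<bar> \<partial>lborel)"
      by (rule integral_abs_bound)
    also have "\<dots> \<le> ?I"
      using f(1) g(1) ints by (intro integral_mono) (auto simp: indicator_def)
    finally show ?thesis .
  qed
  \<comment> \<open>The empty set shows that the supremum is at least 0, which controls the absolute
    value from the other side.\<close>
  have "?d {} \<le> tv_dist (density lborel (\<lambda>x. ennreal (f x))) (density lborel (\<lambda>x. ennreal (g x)))"
    unfolding tv_dist_def using bound by (intro cSUP_upper) (auto simp: bdd_above_def)
  moreover have "tv_dist (density lborel (\<lambda>x. ennreal (f x))) (density lborel (\<lambda>x. ennreal (g x))) \<le> ?I"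
    unfolding tv_dist_def using bound by (intro cSUP_least) auto
  ultimately show ?thesis by simp
qed

text \<open>Under \<open>phi\<close> the mean of \<open>\<bar>prior b - prior b0\<bar>\<close> is at
  most \<open>D = e + M * eta\<close>: at most \<open>e\<close> near \<open>b0\<close>, and at most
  \<open>M\<close> on the tail. Hence the normalising constant \<open>Z\<close> is within
  \<open>D\<close> of \<open>prior b0\<close>, so \<open>Z \<ge> prior b0 / 2\<close>, and the
  \<open>L1\<close> distance is at most \<open>2 * D / Z\<close>.\<close>

lemma tv_dist_reweighted_le:
  fixes phi prior :: "'a::euclidean_space \<Rightarrow> real"
  assumes phi: "phi \<in> borel_measurable borel" "\<And>b. 0 \<le> phi b" "(\<integral>\<^sup>+b. ennreal (phi b) \<partial>lborel) = 1"
    and prior: "prior \<in> borel_measurable borel" "\<And>b. 0 \<le> prior b" "\<And>b. prior b \<le> M"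
    and tail: "(\<integral>\<^sup>+b. ennreal (indicator {b. rho < norm (b - b0)} b * phi b) \<partial>lborel) \<le> ennreal eta" "0 \<le> eta"
    and near: "\<And>b. norm (b - b0) \<le> rho \<Longrightarrow> \<bar>prior b - prior b0\<bar> \<le> e" "0 \<le> e"
    and small: "e + M * eta \<le> prior b0 / 2" and pos: "0 < prior b0"
  shows "\<bar>tv_dist (density lborel (\<lambda>b. ennreal (prior b * phi b / (\<integral>b. prior b * phi b \<partial>lborel)))) (density lborel (\<lambda>b. ennreal (phi b)))\<bar>
    \<le> 4 * (e + M * eta) / prior b0"
proof -
  note [measurable] = phi(1) prior(1)
  define D where "D = e + M * eta"
  define Z where "Z = (\<integral>b. prior b * phi b \<partial>lborel)"
  let ?T = "{b. rho < norm (b - b0)}"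
  have M: "0 \<le> M" using prior(2,3) order_trans by blast
  have int_phi: "integrable lborel phi"
    by (rule integrableI_nonneg) (use phi in auto)
  have one: "(\<integral>b. phi b \<partial>lborel) = 1"
    using phi by (subst integral_eq_nn_integral) auto
  have int_tail: "integrable lborel (\<lambda>b. indicator ?T b * phi b)"
    using int_phi by (rule Bochner_Integration.integrable_bound) (auto simp: indicator_def phi)
  have tail': "(\<integral>b. indicator ?T b * phi b \<partial>lborel) \<le> eta"
  proof -
    have "ennreal (\<integral>b. indicator ?T b * phi b \<partial>lborel) = (\<integral>\<^sup>+b. ennreal (indicator ?T b * phi b) \<partial>lborel)"
      using phi by (intro nn_integral_eq_integral[symmetric] int_tail) auto
    then show ?thesis using tail by (metis ennreal_le_iff)
  qed
  have int_pp: "integrable lborel (\<lambda>b. prior b * phi b)"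
    by (rule Bochner_Integration.integrable_bound[of _ "\<lambda>b. M * phi b"])
      (use int_phi prior phi M in \<open>auto simp: abs_mult intro!: mult_right_mono\<close>)
  have int_dev: "integrable lborel (\<lambda>b. \<bar>prior b - c\<bar> * phi b)" for c
  proof -
    have "integrable lborel (\<lambda>b. \<bar>prior b * phi b - c * phi b\<bar>)" using int_pp int_phi by auto
    moreover have "\<bar>prior b * phi b - c * phi b\<bar> = \<bar>prior b - c\<bar> * phi b" for b
      using phi(2)[of b] by (simp add: left_diff_distrib[symmetric] abs_mult)
    ultimately show ?thesis by simp
  qed
  have dev: "(\<integral>b. \<bar>prior b - prior b0\<bar> * phi b \<partial>lborel) \<le> D"
  proof -
    have "(\<integral>b. \<bar>prior b - prior b0\<bar> * phi b \<partial>lborel) \<le> (\<integral>b. e * phi b + M * (indicator ?T b * phi b) \<partial>lborel)"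
    proof (rule integral_mono[OF int_dev])
      show "integrable lborel (\<lambda>b. e * phi b + M * (indicator ?T b * phi b))" using int_phi int_tail by auto
      fix b
      have "\<bar>prior b - prior b0\<bar> \<le> e + M * indicator ?T b"
      proof (cases "b \<in> ?T")
        case True
        have "\<bar>prior b - prior b0\<bar> \<le> M" using prior(2,3)[of b] prior(2,3)[of b0] by linarith
        then show ?thesis using True near(2) by simp
      qed (use near(1)[of b] in auto)
      then have "\<bar>prior b - prior b0\<bar> * phi b \<le> (e + M * indicator ?T b) * phi b"
        using phi(2) by (rule mult_right_mono)
      then show "\<bar>prior b - prior b0\<bar> * phi b \<le> e * phi b + M * (indicator ?T b * phi b)"
        by (simp add: algebra_simps)
    qed
    also have "\<dots> = e + M * (\<integral>b. indicator ?T b * phi b \<partial>lborel)"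
      using int_phi int_tail one by simp
    also have "\<dots> \<le> D" unfolding D_def using tail' M by (intro add_left_mono mult_left_mono)
    finally show ?thesis .
  qed
  have Zdev: "\<bar>Z - prior b0\<bar> \<le> D"
  proof -
    have "Z - prior b0 = (\<integral>b. prior b * phi b - prior b0 * phi b \<partial>lborel)"
      unfolding Z_def using int_pp int_phi one by simp
    also have "\<bar>\<dots>\<bar> \<le> (\<integral>b. \<bar>prior b * phi b - prior b0 * phi b\<bar> \<partial>lborel)" by (rule integral_abs_bound)
    also have "\<dots> = (\<integral>b. \<bar>prior b - prior b0\<bar> * phi b \<partial>lborel)"
      using phi(2) by (simp add: left_diff_distrib[symmetric] abs_mult)
    finally show ?thesis using dev by simp
  qed
  have D0: "0 \<le> D" unfolding D_def using near(2) M tail(2) by auto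
  have Z: "prior b0 / 2 \<le> Z" using Zdev small by (simp add: D_def)
  then have Zpos: "Z > 0" using pos by simp
  have "(\<integral>b. \<bar>prior b * phi b / Z - phi b\<bar> \<partial>lborel) = (\<integral>b. \<bar>prior b - Z\<bar> * phi b / Z \<partial>lborel)"
  proof (rule Bochner_Integration.integral_cong[OF refl])
    fix b
    have "prior b * phi b / Z - phi b = (prior b - Z) * phi b / Z" using Zpos by (simp add: field_simps)
    then show "\<bar>prior b * phi b / Z - phi b\<bar> = \<bar>prior b - Z\<bar> * phi b / Z"
      using Zpos phi(2)[of b] by (simp add: abs_mult)
  qed
  also have "\<dots> = (\<integral>b. \<bar>prior b - Z\<bar> * phi b \<partial>lborel) / Z" by simp
  also have "\<dots> \<le> (2 * D) / Z"
  proof (rule divide_right_mono)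
    have "(\<integral>b. \<bar>prior b - Z\<bar> * phi b \<partial>lborel) \<le> (\<integral>b. \<bar>prior b - prior b0\<bar> * phi b + D * phi b \<partial>lborel)"
    proof (rule integral_mono[OF int_dev])
      show "integrable lborel (\<lambda>b. \<bar>prior b - prior b0\<bar> * phi b + D * phi b)" using int_dev int_phi by auto
      fix b
      have "\<bar>prior b - Z\<bar> \<le> \<bar>prior b - prior b0\<bar> + D" using Zdev by linarith
      then have "\<bar>prior b - Z\<bar> * phi b \<le> (\<bar>prior b - prior b0\<bar> + D) * phi b"
        using phi(2) by (rule mult_right_mono)
      then show "\<bar>prior b - Z\<bar> * phi b \<le> \<bar>prior b - prior b0\<bar> * phi b + D * phi b"
        by (simp add: algebra_simps)
    qed
    also have "\<dots> = (\<integral>b. \<bar>prior b - prior b0\<bar> * phi b \<partial>lborel) + D"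
      using int_dev int_phi one by simp
    finally show "(\<integral>b. \<bar>prior b - Z\<bar> * phi b \<partial>lborel) \<le> 2 * D" using dev by simp
  qed (use Zpos in simp)
  also have "\<dots> \<le> (2 * D) / (prior b0 / 2)"
    using Z pos D0 by (intro divide_left_mono) auto
  finally have main: "(\<integral>b. \<bar>prior b * phi b / Z - phi b\<bar> \<partial>lborel) \<le> 4 * D / prior b0" by simp
  have "\<bar>tv_dist (density lborel (\<lambda>b. ennreal (prior b * phi b / Z))) (density lborel (\<lambda>b. ennreal (phi b)))\<bar>
     \<le> (\<integral>b. \<bar>prior b * phi b / Z - phi b\<bar> \<partial>lborel)"
    using int_pp int_phi prior(2) phi(2) Zpos by (intro tv_dist_density_le) auto
  with main show ?thesis unfolding Z_def D_def by linarith
qed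

section \<open>Lower bound for integrals of exponentials of quadratics\<close>

lemma nn_integral_lborel_affine:
  fixes f :: "'a::euclidean_space \<Rightarrow> ennreal"
  assumes [measurable]: "f \<in> borel_measurable borel" and c: "c \<noteq> 0"
  shows "(\<integral>\<^sup>+x. f x \<partial>lborel) = ennreal (\<bar>c\<bar> ^ DIM('a)) * (\<integral>\<^sup>+x. f (t + c *\<^sub>R x) \<partial>lborel)"
  by (subst lborel_affine[OF c, of t]) (simp add: nn_integral_density nn_integral_distr nn_integral_cmult)

text \<open>Averaging the integrand over \<open>u + v\<close> and \<open>u - v\<close> removes the first-order term at \<open>u\<close>, which need not be small.\<close>
lemma nn_integral_exp_quadratic_ge:
  fixes A :: "real^'d^'d" and d :: "real^'d"
  assumes lo: "\<And>x. l * (norm x)\<^sup>2 \<le> x \<bullet> (A *v x)" and up: "\<And>x. x \<bullet> (A *v x) \<le> L * (norm x)\<^sup>2"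
    and l: "0 \<le> l" and del: "0 < del" "del < norm d" and r: "0 < r" "r \<le> 1"
  shows "emeasure lborel (ball (0::real^'d) r) * ennreal (exp ((l * del\<^sup>2 - L * r\<^sup>2) / (2 * s\<^sup>2)))
    \<le> (\<integral>\<^sup>+c. indicator (ball 0 (del + 1)) c * ennreal (exp ((c \<bullet> (A *v d) - (c \<bullet> (A *v c)) / 2) / s\<^sup>2)) \<partial>lborel)"
proof -
  define E where "E c = (c \<bullet> (A *v d) - (c \<bullet> (A *v c)) / 2) / s\<^sup>2" for c
  have [measurable]: "E \<in> borel_measurable borel" unfolding E_def by measurable
  \<comment> \<open>\<open>u = t *\<^sub>R d\<close> is the point at distance \<open>del\<close>
    from 0 on the segment to the maximiser \<open>d\<close> of the exponent. It stays in a fixed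
    ball however large \<open>norm d\<close> is.\<close>
  define t where "t = del / norm d"
  have dpos: "0 < norm d" using del by linarith
  then have t: "0 < t" "t < 1" using del by (auto simp: t_def)
  define u where "u = t *\<^sub>R d"
  have nu: "norm u = del" using del dpos by (simp add: u_def t_def)
  have Eu: "l * del\<^sup>2 / (2 * s\<^sup>2) \<le> E u"
  proof -
    have q: "l * del\<^sup>2 \<le> u \<bullet> (A *v u)" using lo[of u] by (simp add: nu)
    \<comment> \<open>Because \<open>t < 1\<close>, the linear term
      \<open>u \<bullet> (A *v d)\<close> is at least the form at \<open>u\<close>, so at least half
      of the form survives in the exponent.\<close>
    have "u \<bullet> (A *v u) = t * (u \<bullet> (A *v d))" by (simp add: u_def matrix_vector_mult_scaleR)
    moreover have "0 \<le> u \<bullet> (A *v u)" using q l by (intro order_trans[OF _ q] mult_nonneg_nonneg) auto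
    ultimately have "u \<bullet> (A *v u) \<le> u \<bullet> (A *v d)"
      using t mult_right_mono[of t 1 "u \<bullet> (A *v d)"] by (simp add: zero_le_mult_iff)
    then have "l * del\<^sup>2 / 2 \<le> u \<bullet> (A *v d) - (u \<bullet> (A *v u)) / 2" using q by linarith
    then have "l * del\<^sup>2 / 2 / s\<^sup>2 \<le> E u" unfolding E_def by (rule divide_right_mono) simp
    then show ?thesis by simp
  qed
  have avg: "(E (u + v) + E (u - v)) / 2 = E u - (v \<bullet> (A *v v)) / (2 * s\<^sup>2)" for v
  proof -
    have "A *v (u + v) = A *v u + A *v v" "A *v (u - v) = A *v u - A *v v"
      by (simp_all add: matrix_vector_right_distrib matrix_vector_mult_diff_distrib)
    then show ?thesis unfolding E_def by (simp add: inner_simps add_divide_distrib diff_divide_distrib)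
  qed
  let ?e = "exp ((l * del\<^sup>2 - L * r\<^sup>2) / (2 * s\<^sup>2))"
  let ?g = "\<lambda>c. indicator (ball u r) c * ennreal (exp (E c))"
  \<comment> \<open>By the inequality of arithmetic and geometric means, the two exponentials at
    \<open>u + v\<close> and \<open>u - v\<close> add up to at least twice the exponential of their
    mean exponent, which \<open>avg\<close> computes.\<close>
  have pt: "indicator (ball 0 r) v * ennreal (2 * ?e) \<le> ?g (u + v) + ?g (u - v)" for v
  proof (cases "v \<in> ball 0 r")
    case True
    then have vr: "norm v < r" by simp
    have "v \<bullet> (A *v v) \<le> L * r\<^sup>2"
    proof -
      have "0 \<le> L"
      proof -
        have "l * (norm u)\<^sup>2 \<le> L * (norm u)\<^sup>2" using lo[of u] up[of u] by linarith
        then show ?thesis using nu del l by (simp add: power2_eq_square)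
      qed
      then have "L * (norm v)\<^sup>2 \<le> L * r\<^sup>2" using vr by (intro mult_left_mono power_mono) auto
      then show ?thesis using up[of v] by linarith
    qed
    then have "(v \<bullet> (A *v v)) / (2 * s\<^sup>2) \<le> L * r\<^sup>2 / (2 * s\<^sup>2)" by (rule divide_right_mono) simp
    then have "(l * del\<^sup>2 - L * r\<^sup>2) / (2 * s\<^sup>2) \<le> (E (u + v) + E (u - v)) / 2"
      unfolding avg using Eu by (simp add: diff_divide_distrib)
    then have "?e \<le> exp ((E (u + v) + E (u - v)) / 2)" by simp
    also have "\<dots> = exp (E (u + v) / 2) * exp (E (u - v) / 2)" by (simp add: exp_add[symmetric] add_divide_distrib)
    finally have "2 * ?e \<le> 2 * (exp (E (u + v) / 2) * exp (E (u - v) / 2))" by simp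
    also have "\<dots> \<le> (exp (E (u + v) / 2))\<^sup>2 + (exp (E (u - v) / 2))\<^sup>2"
      using sum_squares_bound[of "exp (E (u + v) / 2)" "exp (E (u - v) / 2)"] by (simp add: mult.assoc)
    also have "\<dots> = exp (E (u + v)) + exp (E (u - v))" by (simp add: exp_double[symmetric])
    finally have "ennreal (2 * ?e) \<le> ennreal (exp (E (u + v))) + ennreal (exp (E (u - v)))"
      by (simp add: ennreal_plus[symmetric] del: ennreal_plus)
    then show ?thesis using True vr by (simp add: dist_norm)
  qed simp
  have [measurable, simp]: "ball a q \<in> sets borel" for a :: "real^'d" and q by (rule borel_open) simp
  have "2 * (emeasure lborel (ball (0::real^'d) r) * ennreal ?e) = (\<integral>\<^sup>+v. indicator (ball (0::real^'d) r) v * ennreal (2 * ?e) \<partial>lborel)"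
    by (subst nn_integral_multc) (simp_all add: ennreal_mult' mult_ac)
  also have "\<dots> \<le> (\<integral>\<^sup>+v. ?g (u + v) + ?g (u - v) \<partial>lborel)" by (rule nn_integral_mono) (rule pt)
  \<comment> \<open>Translation and reflection preserve Lebesgue measure, so both integrals equal
    the integral of \<open>?g\<close>, and the factor 2 cancels.\<close>
  also have "\<dots> = (\<integral>\<^sup>+v. ?g (u + 1 *\<^sub>R v) \<partial>lborel) + (\<integral>\<^sup>+v. ?g (u + (- 1) *\<^sub>R v) \<partial>lborel)"
    by (subst nn_integral_add) auto
  also have "\<dots> = 2 * (\<integral>\<^sup>+c. ?g c \<partial>lborel)"
    using nn_integral_lborel_affine[of ?g 1 u] nn_integral_lborel_affine[of ?g "- 1" u]
    by (simp add: mult_2)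
  finally have "emeasure lborel (ball (0::real^'d) r) * ennreal ?e \<le> (\<integral>\<^sup>+c. ?g c \<partial>lborel)"
    by (simp add: ennreal_mult_le_mult_iff)
  \<comment> \<open>As \<open>norm u = del\<close> and \<open>r \<le> 1\<close>, the small ball
    around \<open>u\<close> lies in the fixed ball of radius \<open>del + 1\<close>.\<close>
  also have "\<dots> \<le> (\<integral>\<^sup>+c. indicator (ball 0 (del + 1)) c * ennreal (exp (E c)) \<partial>lborel)"
  proof (rule nn_integral_mono)
    fix c
    have "c \<in> ball 0 (del + 1)" if "c \<in> ball u r"
      using that nu r norm_triangle_ineq[of u "c - u"] by (simp add: dist_norm norm_minus_commute)
    then show "?g c \<le> indicator (ball 0 (del + 1)) c * ennreal (exp (E c))"
      by (auto simp: indicator_def)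
  qed
  finally show ?thesis unfolding E_def .
qed

section \<open>Normal equations and the block decomposition\<close>

lemma outer_mult_vec: "outer u v *v b = (v \<bullet> b) *\<^sub>R u"
  by (simp add: outer_def matrix_vector_mult_def vec_eq_iff inner_vec_def sum_distrib_left sum_distrib_right mult_ac)

lemma gram_mult_vec:
  fixes f :: "nat \<Rightarrow> real^'n"
  shows "(\<Sum>j<n. outer (f j) (f j)) *v b = (\<Sum>j<n. (f j \<bullet> b) *\<^sub>R f j)"
  by (induction n) (simp_all add: matrix_vector_mult_add_rdistrib outer_mult_vec)

lemma transpose_gram:
  fixes f :: "nat \<Rightarrow> real^'n"
  shows "transpose (\<Sum>j<n. outer (f j) (f j)) = (\<Sum>j<n. outer (f j) (f j))"
  by (simp add: vec_eq_iff transpose_def outer_def mult.commute)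

lemma XtX_mult_vec: "XtX n h *v b = (\<Sum>j<n. (fst (h j) \<bullet> b) *\<^sub>R fst (h j))"
  by (simp add: XtX_def gram_mult_vec)

lemma info_block_mult_vec: "info_block i n h *v c = (\<Sum>j<n. (T i (fst (h j)) \<bullet> c) *\<^sub>R T i (fst (h j)))"
  by (simp add: info_block_def gram_mult_vec)

lemma transpose_XtX: "transpose (XtX n h) = XtX n h"
  by (simp add: XtX_def transpose_gram)

lemma transpose_info_block: "transpose (info_block i n h) = info_block i n h"
  by (simp add: info_block_def transpose_gram)

text \<open>Pythagoras: the normal equations make the residual at \<open>m\<close> orthogonal to the
  column space of the design, so the cross term vanishes. As a function of \<open>b\<close> the
  likelihood is thus a Gaussian kernel centred at \<open>m\<close> with precision
  \<open>XtX n h\<close> divided by \<open>sg\<^sup>2\<close>.\<close>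

lemma likelihood_normal_equations:
  assumes eq: "XtX n h *v m = Xty n h"
  shows "likelihood sg n h b = likelihood sg n h m * exp (- ((b - m) \<bullet> (XtX n h *v (b - m))) / (2 * sg\<^sup>2))"
proof -
  let ?x = "\<lambda>j. fst (h j)" and ?y = "\<lambda>j. snd (h j)"
  have "0 = (Xty n h - XtX n h *v m) \<bullet> (b - m)" by (simp add: eq)
  also have "\<dots> = (\<Sum>j<n. (?y j - ?x j \<bullet> m) * (?x j \<bullet> (b - m)))"
    by (simp only: Xty_def XtX_mult_vec sum_subtractf[symmetric] inner_sum_left scaleR_diff_left[symmetric] inner_scaleR_left)
  finally have cross: "(\<Sum>j<n. (?y j - ?x j \<bullet> m) * (?x j \<bullet> (b - m))) = 0" by simp
  have quad: "(b - m) \<bullet> (XtX n h *v (b - m)) = (\<Sum>j<n. (?x j \<bullet> (b - m))\<^sup>2)"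
    by (simp only: XtX_mult_vec inner_sum_right inner_scaleR_right power2_eq_square) (simp add: inner_commute)
  have "(\<Sum>j<n. (?y j - ?x j \<bullet> b)\<^sup>2) = (\<Sum>j<n. (?y j - ?x j \<bullet> m)\<^sup>2 + (?x j \<bullet> (b - m))\<^sup>2 - 2 * ((?y j - ?x j \<bullet> m) * (?x j \<bullet> (b - m))))"
    by (rule sum.cong) (auto simp: inner_diff_right power2_eq_square algebra_simps)
  also have "\<dots> = (\<Sum>j<n. (?y j - ?x j \<bullet> m)\<^sup>2) + (b - m) \<bullet> (XtX n h *v (b - m))"
    by (simp only: sum_subtractf sum.distrib sum_distrib_left[symmetric] cross quad mult_zero_right diff_zero)
  finally have ssq: "(\<Sum>j<n. (?y j - ?x j \<bullet> b)\<^sup>2) = (\<Sum>j<n. (?y j - ?x j \<bullet> m)\<^sup>2) + (b - m) \<bullet> (XtX n h *v (b - m))" .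
  have lik: "likelihood sg n h c = exp (- (\<Sum>j<n. (?y j - ?x j \<bullet> c)\<^sup>2) / (2 * sg\<^sup>2))" for c
    by (simp add: likelihood_def exp_sum[symmetric] sum_negf sum_divide_distrib)
  show ?thesis
    unfolding lik ssq exp_add[symmetric] by (simp add: diff_divide_distrib)
qed

section \<open>Coordinate blocks\<close>

lemma T_simps [simp]:
  "T i (x + y) = T i x + T i y" "T i (x - y) = T i x - T i y" "T i (c *\<^sub>R x) = c *\<^sub>R T i x" "T i 0 = 0"
  by (simp_all add: T_def vec_eq_iff)

lemma T_sum: "T i (\<Sum>j\<in>S. f j) = (\<Sum>j\<in>S. T i (f j))"
  by (simp add: T_def vec_eq_iff)

lemma inner_blocks: "x \<bullet> y = (\<Sum>i\<in>UNIV. T i x \<bullet> T i y)"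
  by (simp add: inner_vec_def T_def sum.cartesian_product UNIV_Times_UNIV[symmetric] del: UNIV_Times_UNIV)

lemma norm_blocks: "(norm x)\<^sup>2 = (\<Sum>i\<in>UNIV. (norm (T i x))\<^sup>2)"
  by (simp only: power2_norm_eq_inner inner_blocks[of x x])

lemma Xset_T_cases:
  assumes "x \<in> Xset"
  obtains k where "\<And>i. i \<noteq> k \<Longrightarrow> T i x = 0" "\<And>b. x \<bullet> b = T k x \<bullet> T k b"
proof -
  obtain k where k: "x \<in> block k" using assms by (auto simp: Xset_def)
  have z: "T i x = 0" if "i \<noteq> k" for i using k that by (simp add: block_def T_def vec_eq_iff)
  have "x \<bullet> b = T k x \<bullet> T k b" for b
    unfolding inner_blocks[of x b] by (subst sum.remove[of _ k]) (auto simp: z)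
  with z show ?thesis by (rule that)
qed

text \<open>Each covariate meets a single block, so its square contributes no cross terms:
  \<open>XtX\<close> is block diagonal with blocks \<open>info_block i\<close>.\<close>

lemma XtX_form_blocks:
  assumes X: "\<And>j. j < n \<Longrightarrow> fst (h j) \<in> Xset"
  shows "b \<bullet> (XtX n h *v b) = (\<Sum>i\<in>UNIV. T i b \<bullet> (info_block i n h *v T i b))"
proof -
  have "(fst (h j) \<bullet> b)\<^sup>2 = (\<Sum>i\<in>UNIV. (T i (fst (h j)) \<bullet> T i b)\<^sup>2)" if j: "j < n" for j
  proof -
    obtain k where k: "\<And>i. i \<noteq> k \<Longrightarrow> T i (fst (h j)) = 0" "\<And>b. fst (h j) \<bullet> b = T k (fst (h j)) \<bullet> T k b"
      using Xset_T_cases[OF X[OF j]] by blast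
    show ?thesis by (subst sum.remove[of _ k]) (auto simp: k)
  qed
  then have "(\<Sum>j<n. (fst (h j) \<bullet> b)\<^sup>2) = (\<Sum>i\<in>UNIV. \<Sum>j<n. (T i (fst (h j)) \<bullet> T i b)\<^sup>2)"
    by (subst sum.swap) simp
  then show ?thesis
    by (simp add: XtX_mult_vec info_block_mult_vec inner_sum_right power2_eq_square inner_commute)
qed

lemma T_XtX_mult_vec:
  assumes X: "\<And>j. j < n \<Longrightarrow> fst (h j) \<in> Xset"
  shows "T i (XtX n h *v b) = info_block i n h *v T i b"
proof -
  have "(fst (h j) \<bullet> b) *\<^sub>R T i (fst (h j)) = (T i (fst (h j)) \<bullet> T i b) *\<^sub>R T i (fst (h j))" if j: "j < n" for j
  proof -
    obtain k where k: "\<And>i. i \<noteq> k \<Longrightarrow> T i (fst (h j)) = 0" "\<And>b. fst (h j) \<bullet> b = T k (fst (h j)) \<bullet> T k b"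
      using Xset_T_cases[OF X[OF j]] by blast
    show ?thesis by (cases "i = k") (simp_all add: k)
  qed
  then show ?thesis
    by (simp only: XtX_mult_vec info_block_mult_vec T_sum T_simps) (rule sum.cong, auto)
qed

text \<open>The adjoint of \<open>T i\<close>. It supplies the parameter perturbations that only the
  observations in block \<open>i\<close> can detect.\<close>

definition embed_block :: "'m \<Rightarrow> real^'d \<Rightarrow> real^('m::finite \<times> 'd::finite)" where
  "embed_block i c = (\<chi> kl. if fst kl = i then c $ snd kl else 0)"

lemma T_embed_block: "T k (embed_block i c) = (if k = i then c else 0)"
  by (simp add: T_def embed_block_def vec_eq_iff)

lemma inner_embed_block: "embed_block i c \<bullet> x = c \<bullet> T i x"
  unfolding inner_blocks[of _ x] T_embed_block by (subst sum.remove[of _ i]) auto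

lemma measurable_embed_block [measurable]: "embed_block i \<in> borel_measurable borel"
proof -
  have "linear (embed_block i)" by (rule linearI) (auto simp: embed_block_def vec_eq_iff)
  then show ?thesis by (intro borel_measurable_continuous_onI linear_continuous_on) (simp add: linear_linear)
qed

text \<open>The linear term of the log ratio is the score at \<open>beta0\<close>. By the normal
  equations the score is \<open>XtX n h *v (m - beta0)\<close>, whose block \<open>i\<close>
  involves only \<open>info_block i\<close> and the error in that block.\<close>

lemma lratio_embed_block:
  assumes X: "\<And>j. j < n \<Longrightarrow> fst (h j) \<in> Xset" and eq: "XtX n h *v m = Xty n h"
  shows "lratio beta0 sg n (embed_block i c) h
    = exp ((c \<bullet> (info_block i n h *v T i (m - beta0)) - (c \<bullet> (info_block i n h *v c)) / 2) / sg\<^sup>2)"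
proof -
  let ?x = "\<lambda>j. fst (h j)" and ?y = "\<lambda>j. snd (h j)"
  have "info_block i n h *v T i (m - beta0) = T i (XtX n h *v (m - beta0))" by (simp only: T_XtX_mult_vec[OF X])
  also have "\<dots> = T i (Xty n h - XtX n h *v beta0)" by (simp add: matrix_vector_mult_diff_distrib eq)
  also have "\<dots> = (\<Sum>j<n. (?y j - ?x j \<bullet> beta0) *\<^sub>R T i (?x j))"
    by (simp add: Xty_def XtX_mult_vec T_sum sum_subtractf scaleR_diff_left)
  finally have lin: "c \<bullet> (info_block i n h *v T i (m - beta0)) = (\<Sum>j<n. (c \<bullet> T i (?x j)) * (?y j - ?x j \<bullet> beta0))"
    by (simp only: inner_sum_right inner_scaleR_right mult.commute)
  have quad: "c \<bullet> (info_block i n h *v c) = (\<Sum>j<n. (c \<bullet> T i (?x j))\<^sup>2)"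
    by (simp add: info_block_mult_vec inner_sum_right power2_eq_square inner_commute)
  show ?thesis
    unfolding lin quad lratio_def inner_embed_block
    by (simp add: exp_sum[symmetric] sum_divide_distrib sum_subtractf diff_divide_distrib)
qed

section \<open>Consistency and the posterior\<close>

text \<open>Merges the thresholds of finitely many blocks into one, and picks the exceptional events
  of all blocks together.\<close>

lemma choice_eventually_finite:
  fixes P :: "'i::finite \<Rightarrow> nat \<Rightarrow> 'b \<Rightarrow> bool"
  assumes "\<And>i. \<exists>N. \<forall>n\<ge>N. \<exists>B. P i n B"
  shows "\<exists>N. \<forall>n\<ge>N. \<exists>B. \<forall>i. P i n (B i)"
proof -
  have "eventually (\<lambda>n. \<forall>i. \<exists>B. P i n B) sequentially"
    using assms by (intro eventually_all_finite) (simp add: eventually_sequentially)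
  then show ?thesis by (simp add: eventually_sequentially choice_iff)
qed

lemma XtX_form_ge:
  assumes X: "\<And>j. j < n \<Longrightarrow> fst (h j) \<in> Xset" and lmin: "\<And>i. K \<le> lambda_min (info_block i n h)"
  shows "K * (norm b)\<^sup>2 \<le> b \<bullet> (XtX n h *v b)"
proof -
  have "K * (norm b)\<^sup>2 = (\<Sum>i\<in>UNIV. K * (norm (T i b))\<^sup>2)" by (simp add: norm_blocks[of b] sum_distrib_left)
  also have "\<dots> \<le> (\<Sum>i\<in>UNIV. T i b \<bullet> (info_block i n h *v T i b))"
  proof (rule sum_mono)
    fix i
    have "K * (norm (T i b))\<^sup>2 \<le> lambda_min (info_block i n h) * (norm (T i b))\<^sup>2"
      using lmin by (intro mult_right_mono) auto
    then show "K * (norm (T i b))\<^sup>2 \<le> T i b \<bullet> (info_block i n h *v T i b)"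
      using lambda_min_le_form[OF transpose_info_block, of i n h "T i b"] by linarith
  qed
  finally show ?thesis by (simp only: XtX_form_blocks[OF X])
qed

lemma XtX_pos_def:
  assumes X: "\<And>j. j < n \<Longrightarrow> fst (h j) \<in> Xset" and lmin: "\<And>i. K \<le> lambda_min (info_block i n h)" and K: "0 < K"
    and b: "b \<noteq> 0"
  shows "0 < b \<bullet> (XtX n h *v b)"
proof -
  have "0 < K * (norm b)\<^sup>2" using K b by simp
  also note XtX_form_ge[OF X lmin]
  finally show ?thesis .
qed

lemma normal_equations_beta_hat:
  assumes "\<And>b. b \<noteq> 0 \<Longrightarrow> 0 < b \<bullet> (XtX n h *v b)"
  shows "XtX n h *v beta_hat n h = Xty n h"
  using pos_def_invertible(1)[OF transpose_XtX assms] by (simp add: beta_hat_def matrix_vector_mul_assoc)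

section \<open>Mixtures of likelihood ratios and consistency\<close>

text \<open>The method of mixtures with unnormalised Lebesgue weight on a ball. It takes values in
  \<open>ennreal\<close>, so no integrability needs to be established.\<close>

definition block_mixture :: "real^('m::finite \<times> 'd::finite) \<Rightarrow> real \<Rightarrow> real \<Rightarrow> 'm \<Rightarrow> nat \<Rightarrow> (nat \<Rightarrow> (real^('m \<times> 'd)) \<times> real) \<Rightarrow> ennreal" where
  "block_mixture beta0 sg R i n h = (\<integral>\<^sup>+c. indicator (ball 0 R) c * ennreal (lratio beta0 sg n (embed_block i c) h) \<partial>lborel)"

text \<open>The deterministic core of consistency. A block error above \<open>del\<close> would make
  the mixture at least \<open>B\<close>: it gains the exponential of
  \<open>del\<^sup>2 / (2 * sg\<^sup>2)\<close> times the least eigenvalue and loses a power of the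
  largest one, and \<open>lmax\<close> lets half of the gain pay for that loss.\<close>

lemma beta_hat_block_close:
  fixes h :: "nat \<Rightarrow> (real^('m::finite \<times> 'd::finite)) \<times> real"
  assumes sg: "sg > 0" and del: "del > 0"
    and X: "\<And>j. j < n \<Longrightarrow> fst (h j) \<in> Xset"
    and lmin: "\<And>i. K \<le> lambda_min (info_block i n h)" and K: "1 \<le> K" "sg\<^sup>2 \<le> K"
    and lmax: "\<bar>ln (lambda_max (info_block i n h)) / lambda_min (info_block i n h)\<bar> \<le> del\<^sup>2 / (2 * sg\<^sup>2 * CARD('d))"
    and mix: "block_mixture beta0 sg (del + 1) i n h < ennreal B"
    and B: "B \<le> unit_ball_vol (real CARD('d)) * sg ^ CARD('d) * exp (- (1/2)) * exp (del\<^sup>2 / (4 * sg\<^sup>2) * K)"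
  shows "norm (T i (beta_hat n h - beta0)) \<le> del"
proof (rule ccontr)
  assume "\<not> ?thesis"
  then have far: "del < norm (T i (beta_hat n h - beta0))" by simp
  let ?A = "info_block i n h" and ?D = "CARD('d)"
  define l where "l = lambda_min ?A"
  define L where "L = lambda_max ?A"
  define V where "V = unit_ball_vol (real ?D)"
  have V: "0 \<le> V" by (simp add: V_def)
  have l: "K \<le> l" "1 \<le> l" using lmin[of i] K by (auto simp: l_def)
  have lL: "l \<le> L" unfolding l_def L_def by (rule lambda_min_le_lambda_max[OF transpose_info_block])
  have L: "0 < L" "sg\<^sup>2 \<le> L" using l lL K by auto
  have eq: "XtX n h *v beta_hat n h = Xty n h"
    using K by (intro normal_equations_beta_hat XtX_pos_def[OF X lmin]) auto
  \<comment> \<open>This radius makes \<open>L * r\<^sup>2 = sg\<^sup>2\<close>, so the curvature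
    costs only the constant factor \<open>exp (- (1/2))\<close>, while the volume of the ball is of
    order \<open>L\<close> to the power \<open>- ?D / 2\<close>. The bound
    \<open>sg\<^sup>2 \<le> K\<close> ensures \<open>r \<le> 1\<close>.\<close>
  define r where "r = sg / sqrt L"
  have r: "0 < r" "r \<le> 1"
    using sg L real_sqrt_le_mono[OF L(2)] by (auto simp: r_def)
  have Lr: "L * r\<^sup>2 = sg\<^sup>2" using L by (simp add: r_def power_divide)
  have "emeasure lborel (ball (0::real^'d) r) * ennreal (exp ((l * del\<^sup>2 - L * r\<^sup>2) / (2 * sg\<^sup>2)))
      \<le> (\<integral>\<^sup>+c. indicator (ball 0 (del + 1)) c * ennreal (exp ((c \<bullet> (?A *v T i (beta_hat n h - beta0)) - (c \<bullet> (?A *v c)) / 2) / sg\<^sup>2)) \<partial>lborel)"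
    by (rule nn_integral_exp_quadratic_ge)
      (use l far del r in \<open>auto simp: l_def L_def lambda_min_le_form form_le_lambda_max transpose_info_block\<close>)
  also have "\<dots> = block_mixture beta0 sg (del + 1) i n h"
    by (simp only: block_mixture_def lratio_embed_block[OF X eq])
  also note mix
  also have "emeasure lborel (ball (0::real^'d) r) * ennreal (exp ((l * del\<^sup>2 - L * r\<^sup>2) / (2 * sg\<^sup>2)))
     = ennreal (V * r ^ ?D * exp ((l * del\<^sup>2 - L * r\<^sup>2) / (2 * sg\<^sup>2)))"
    using r V by (subst emeasure_ball) (auto simp: V_def ennreal_mult)
  finally have "V * r ^ ?D * exp ((l * del\<^sup>2 - L * r\<^sup>2) / (2 * sg\<^sup>2)) < B"
    using V r by (subst (asm) ennreal_less_iff) auto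
  moreover have "B \<le> V * r ^ ?D * exp ((l * del\<^sup>2 - L * r\<^sup>2) / (2 * sg\<^sup>2))"
  proof -
    have "ln L / l \<le> del\<^sup>2 / (2 * sg\<^sup>2 * ?D)" unfolding l_def L_def by (rule order_trans[OF abs_ge_self lmax])
    then have "ln L \<le> del\<^sup>2 / (2 * sg\<^sup>2 * ?D) * l" using l by (simp add: pos_divide_le_eq)
    then have "?D * ln L / 2 \<le> ?D * (del\<^sup>2 / (2 * sg\<^sup>2 * ?D) * l) / 2"
      by (intro divide_right_mono mult_left_mono) auto
    also have "\<dots> = del\<^sup>2 / (4 * sg\<^sup>2) * l" by simp
    finally have lnL: "?D * ln L / 2 \<le> del\<^sup>2 / (4 * sg\<^sup>2) * l" .
    have "sqrt L ^ ?D = exp (?D * ln L / 2)"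
    proof -
      have "sqrt L = exp (ln L / 2)" using L by (simp add: ln_sqrt[symmetric])
      then show ?thesis by (simp add: exp_of_nat_mult[symmetric])
    qed
    then have rD: "r ^ ?D = sg ^ ?D * exp (- (?D * ln L / 2))"
      by (simp add: r_def power_divide exp_minus field_simps)
    \<comment> \<open>Up to the constant, the exponent consists of two equal copies: one absorbs
      \<open>?D * ln L / 2\<close> by \<open>lnL\<close>, and the other exceeds its value at
      \<open>K\<close>.\<close>
    have ex: "(l * del\<^sup>2 - L * r\<^sup>2) / (2 * sg\<^sup>2) = 2 * (del\<^sup>2 / (4 * sg\<^sup>2) * l) - 1/2"
      unfolding Lr using sg by (simp add: field_simps)
    have "del\<^sup>2 / (4 * sg\<^sup>2) * K \<le> del\<^sup>2 / (4 * sg\<^sup>2) * l" using l by (intro mult_left_mono) auto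
    then have "- (1/2) + del\<^sup>2 / (4 * sg\<^sup>2) * K \<le> - (?D * ln L / 2) + (l * del\<^sup>2 - L * r\<^sup>2) / (2 * sg\<^sup>2)"
      unfolding ex using lnL by linarith
    then have "exp (- (1/2)) * exp (del\<^sup>2 / (4 * sg\<^sup>2) * K) \<le> exp (- (?D * ln L / 2)) * exp ((l * del\<^sup>2 - L * r\<^sup>2) / (2 * sg\<^sup>2))"
      by (simp only: exp_add[symmetric] exp_le_cancel_iff)
    then have "V * sg ^ ?D * (exp (- (1/2)) * exp (del\<^sup>2 / (4 * sg\<^sup>2) * K))
       \<le> V * sg ^ ?D * (exp (- (?D * ln L / 2)) * exp ((l * del\<^sup>2 - L * r\<^sup>2) / (2 * sg\<^sup>2)))"
      using V sg by (intro mult_left_mono) auto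
    then show ?thesis using B unfolding rD V_def by (simp only: mult.assoc)
  qed
  ultimately show False by simp
qed

text \<open>Tonelli: every likelihood ratio has mean 1, so only the volume of the ball remains. The
  expectation is therefore the same for all \<open>n\<close> and all sampling rules.\<close>

lemma
  fixes Lam :: "nat \<Rightarrow> (nat \<Rightarrow> (real^('m::finite \<times> 'd::finite)) \<times> real) \<Rightarrow> (real^('m \<times> 'd)) measure"
  assumes sg: "sg > 0" and Lam: "\<And>j. Lam j \<in> PiM {..<j} (\<lambda>_. borel) \<rightarrow>\<^sub>M prob_algebra borel"
  shows measurable_block_mixture: "block_mixture beta0 sg R i n \<in> borel_measurable (hist Lam beta0 sg n)"
    and nn_integral_block_mixture: "(\<integral>\<^sup>+h. block_mixture beta0 sg R i n h \<partial>hist Lam beta0 sg n) = emeasure lborel (ball (0::real^'d) R)"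
proof -
  let ?H = "hist Lam beta0 sg n" and ?P = "PiM {..<n} (\<lambda>_. borel :: ((real^('m \<times> 'd)) \<times> real) measure)"
  interpret H: prob_space ?H by (rule prob_space_hist[OF sg Lam])
  interpret pair_sigma_finite ?H "lborel :: (real^'d) measure" ..
  have [measurable, simp]: "ball a q \<in> sets borel" for a :: "real^'d" and q by (rule borel_open) simp
  have "(\<lambda>(h, c). (embed_block i c, h)) \<in> ?P \<Otimes>\<^sub>M borel \<rightarrow>\<^sub>M borel \<Otimes>\<^sub>M ?P" by measurable
  from measurable_compose[OF this measurable_lratio[of beta0 sg n]]
  have "(\<lambda>(h, c). lratio beta0 sg n (embed_block i c) h) \<in> borel_measurable (?P \<Otimes>\<^sub>M borel)"
    by (simp add: case_prod_beta')
  then have [measurable]: "(\<lambda>(h, c). lratio beta0 sg n (embed_block i c) h) \<in> borel_measurable (?H \<Otimes>\<^sub>M lborel)"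
    by (subst measurable_cong_sets[OF sets_pair_measure_cong[OF sets_hist[OF sg Lam] sets_lborel] refl])
  have meas: "(\<lambda>(h, c). indicator (ball 0 R) c * ennreal (lratio beta0 sg n (embed_block i c) h)) \<in> borel_measurable (?H \<Otimes>\<^sub>M lborel)"
    unfolding case_prod_beta' by measurable
  show "block_mixture beta0 sg R i n \<in> borel_measurable ?H"
    unfolding block_mixture_def[abs_def] using meas by (intro lborel.borel_measurable_nn_integral) auto
  have lr: "(\<lambda>h. ennreal (lratio beta0 sg n b h)) \<in> borel_measurable ?H" for b
    using measurable_compose[OF measurable_Pair1'[of b borel] measurable_lratio[of beta0 sg n]]
    by (simp add: measurable_cong_sets[OF sets_hist[OF sg Lam] refl] measurable_compose)
  have "(\<integral>\<^sup>+h. block_mixture beta0 sg R i n h \<partial>?H)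
     = (\<integral>\<^sup>+c. \<integral>\<^sup>+h. indicator (ball 0 R) c * ennreal (lratio beta0 sg n (embed_block i c) h) \<partial>?H \<partial>lborel)"
    unfolding block_mixture_def using Fubini'[OF meas] by simp
  also have "\<dots> = (\<integral>\<^sup>+c. indicator (ball (0::real^'d) R) c \<partial>lborel)"
    by (subst nn_integral_cmult[OF lr]) (simp add: nn_integral_lratio[OF sg Lam])
  also have "\<dots> = emeasure lborel (ball (0::real^'d) R)" by simp
  finally show "(\<integral>\<^sup>+h. block_mixture beta0 sg R i n h \<partial>?H) = emeasure lborel (ball (0::real^'d) R)" .
qed

text \<open>Markov's inequality applied to the mean of the mixture; the bound is uniform in
  \<open>n\<close>.\<close>

lemma block_mixture_tail:
  fixes Lam :: "nat \<Rightarrow> (nat \<Rightarrow> (real^('m::finite \<times> 'd::finite)) \<times> real) \<Rightarrow> (real^('m \<times> 'd)) measure"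
  assumes sg: "sg > 0" and Lam: "\<And>j. Lam j \<in> PiM {..<j} (\<lambda>_. borel) \<rightarrow>\<^sub>M prob_algebra borel" and B: "B > 0"
  shows "{h \<in> space (hist Lam beta0 sg n). ennreal B \<le> block_mixture beta0 sg R i n h} \<in> sets (hist Lam beta0 sg n)"
    and "measure (hist Lam beta0 sg n) {h \<in> space (hist Lam beta0 sg n). ennreal B \<le> block_mixture beta0 sg R i n h}
      \<le> measure lborel (ball (0::real^'d) R) / B"
proof -
  let ?H = "hist Lam beta0 sg n"
  interpret H: prob_space ?H by (rule prob_space_hist[OF sg Lam])
  note [measurable] = measurable_block_mixture[OF sg Lam, of beta0 R i n]
  show sets: "{h \<in> space ?H. ennreal B \<le> block_mixture beta0 sg R i n h} \<in> sets ?H" by measurable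
  have "{h \<in> space ?H. ennreal B \<le> block_mixture beta0 sg R i n h} = {h \<in> space ?H. 1 \<le> ennreal (1 / B) * block_mixture beta0 sg R i n h}"
  proof -
    have "ennreal B \<le> y \<longleftrightarrow> 1 \<le> ennreal (1 / B) * y" for y
    proof -
      have "ennreal (1 / B) * ennreal B = 1" using B by (simp add: ennreal_mult''[symmetric])
      moreover have "ennreal (1 / B) * ennreal B \<le> ennreal (1 / B) * y \<longleftrightarrow> ennreal B \<le> y"
        using B by (intro ennreal_mult_le_mult_iff) auto
      ultimately show ?thesis by simp
    qed
    then show ?thesis by simp
  qed
  also have "emeasure ?H \<dots> \<le> ennreal (1 / B) * (\<integral>\<^sup>+h. block_mixture beta0 sg R i n h * indicator (space ?H) h \<partial>?H)"
    by (rule nn_integral_Markov_inequality) measurable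
  also have "(\<integral>\<^sup>+h. block_mixture beta0 sg R i n h * indicator (space ?H) h \<partial>?H) = (\<integral>\<^sup>+h. block_mixture beta0 sg R i n h \<partial>?H)"
    by (rule nn_integral_cong) (simp only: indicator_simps mult_1_right)
  also have "ennreal (1 / B) * \<dots> = ennreal (1 / B * measure lborel (ball (0::real^'d) R))"
    unfolding nn_integral_block_mixture[OF sg Lam] using B emeasure_lborel_ball_finite[of "0::real^'d" R]
    by (subst emeasure_eq_ennreal_measure) (auto simp: ennreal_mult''[symmetric])
  finally show "measure ?H {h \<in> space ?H. ennreal B \<le> block_mixture beta0 sg R i n h} \<le> measure lborel (ball (0::real^'d) R) / B"
    unfolding H.emeasure_eq_measure using B by (subst (asm) ennreal_le_iff) auto
qed

section \<open>From the posterior to the normal approximation\<close>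

text \<open>The likelihood is a constant multiple of the approximating normal density
  \<open>phi\<close>, and the constant cancels in the posterior. The posterior is thus
  \<open>phi\<close> reweighted by the prior, and the reweighting bound applies once
  \<open>phi\<close> has little mass far from \<open>beta0\<close>.\<close>

lemma tv_dist_posterior_mvn_le:
  fixes h :: "nat \<Rightarrow> (real^'n) \<times> real"
  assumes sg: "sg > 0" and form: "\<And>b. K * (norm b)\<^sup>2 \<le> b \<bullet> (XtX n h *v b)" and K: "0 < K"
    and close: "norm (beta_hat n h - beta0) \<le> rho / 2" and rho: "0 < rho"
    and prior: "prior \<in> borel_measurable borel" "\<And>b. 0 \<le> prior b" "\<And>b. prior b \<le> M"
    and near: "\<And>b. norm (b - beta0) \<le> rho \<Longrightarrow> \<bar>prior b - prior beta0\<bar> \<le> e" "0 \<le> e"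
    and eta: "exp (- (K / sg\<^sup>2) * (rho / 2)\<^sup>2 / 4) * sqrt (2 ^ CARD('n)) \<le> eta"
    and small: "e + M * eta \<le> prior beta0 / 2" and pos: "0 < prior beta0"
  shows "\<bar>tv_dist (posterior prior sg n h) (mvn (beta_hat n h) (sg\<^sup>2 *\<^sub>R matrix_inv (XtX n h)))\<bar>
    \<le> 4 * (e + M * eta) / prior beta0"
proof -
  let ?m = "beta_hat n h" and ?G = "XtX n h"
  define A where "A = (1 / sg\<^sup>2) *\<^sub>R ?G"
  have A_mult: "b \<bullet> (A *v c) = (b \<bullet> (?G *v c)) / sg\<^sup>2" for b c
    by (simp add: A_def scaleR_matrix_vector_assoc[symmetric])
  have symA: "transpose A = A" by (simp add: A_def transpose_scalar transpose_XtX)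
  have pdG: "0 < b \<bullet> (?G *v b)" if "b \<noteq> 0" for b
  proof -
    have "0 < K * (norm b)\<^sup>2" using K that by simp
    also note form
    finally show ?thesis .
  qed
  then have pdA: "0 < b \<bullet> (A *v b)" if "b \<noteq> 0" for b using sg that by (simp add: A_mult)
  have formA: "K / sg\<^sup>2 * (norm b)\<^sup>2 \<le> b \<bullet> (A *v b)" for b
    using divide_right_mono[OF form[of b], of "sg\<^sup>2"] by (simp add: A_mult)
  have "A ** (sg\<^sup>2 *\<^sub>R matrix_inv ?G) = mat 1"
    using sg pos_def_invertible(1)[OF transpose_XtX pdG]
    by (simp add: A_def matrix_scalar_ac scalar_matrix_assoc[symmetric])
  then have S: "sg\<^sup>2 *\<^sub>R matrix_inv ?G = matrix_inv A" by (rule matrix_inv_eqI[symmetric])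
  define phi where "phi = mvn_density ?m (matrix_inv A)"
  have phi_eq: "phi b = exp (- ((b - ?m) \<bullet> (A *v (b - ?m))) / 2) / sqrt ((2 * pi) ^ CARD('n) / det A)" for b
    unfolding phi_def by (rule mvn_density_matrix_inv[OF symA pdA])
  have detA: "det A > 0" by (rule pos_def_det_pos[OF symA pdA])
  have phi0: "0 \<le> phi b" for b unfolding phi_eq using detA by simp
  define C where "C = likelihood sg n h ?m * sqrt ((2 * pi) ^ CARD('n) / det A)"
  have C: "0 < C" using detA by (auto simp: C_def likelihood_def intro!: mult_pos_pos prod_pos divide_pos_pos)
  have lik: "likelihood sg n h b = C * phi b" for b
  proof -
    have "likelihood sg n h b = likelihood sg n h ?m * exp (- ((b - ?m) \<bullet> (?G *v (b - ?m))) / (2 * sg\<^sup>2))"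
      by (rule likelihood_normal_equations[OF normal_equations_beta_hat[OF pdG]])
    also have "- ((b - ?m) \<bullet> (?G *v (b - ?m))) / (2 * sg\<^sup>2) = - ((b - ?m) \<bullet> (A *v (b - ?m))) / 2"
      by (simp add: A_mult)
    finally show ?thesis using detA unfolding phi_eq C_def by simp
  qed
  have "(\<integral>b. prior b * likelihood sg n h b \<partial>lborel) = C * (\<integral>b. prior b * phi b \<partial>lborel)"
    unfolding lik by (subst integral_mult_right_zero[symmetric]) (simp add: mult_ac)
  then have post: "posterior prior sg n h = density lborel (\<lambda>b. ennreal (prior b * phi b / (\<integral>b. prior b * phi b \<partial>lborel)))"
    using C by (simp add: posterior_def lik mult.left_commute)
  have "\<bar>tv_dist (density lborel (\<lambda>b. ennreal (prior b * phi b / (\<integral>b. prior b * phi b \<partial>lborel)))) (density lborel (\<lambda>b. ennreal (phi b)))\<bar>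
    \<le> 4 * (e + M * eta) / prior beta0"
  proof (rule tv_dist_reweighted_le[where rho = rho])
    show "phi \<in> borel_measurable borel" unfolding phi_def by measurable
    show "(\<integral>\<^sup>+b. ennreal (phi b) \<partial>lborel) = 1" unfolding phi_def by (rule nn_integral_mvn_density[OF symA pdA])
    show "0 \<le> eta" using eta by (rule order_trans[rotated]) simp
    \<comment> \<open>Since \<open>beta_hat\<close> is within \<open>rho / 2\<close> of
      \<open>beta0\<close>, leaving the \<open>rho\<close>-ball around \<open>beta0\<close> means
      leaving the \<open>rho / 2\<close>-ball around \<open>beta_hat\<close>, where the Gaussian
      tail bound applies.\<close>
    have "(\<integral>\<^sup>+b. ennreal (indicator {b. rho < norm (b - beta0)} b * phi b) \<partial>lborel)
      \<le> (\<integral>\<^sup>+b. ennreal (indicator {b. rho / 2 < norm (b - ?m)} b * phi b) \<partial>lborel)"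
    proof (intro nn_integral_mono ennreal_leI mult_right_mono phi0)
      fix b
      have "rho / 2 < norm (b - ?m)" if "rho < norm (b - beta0)"
        using that close norm_triangle_ineq[of "b - ?m" "?m - beta0"] by simp
      then show "indicator {b. rho < norm (b - beta0)} b \<le> (indicator {b. rho / 2 < norm (b - ?m)} b :: real)"
        by (auto simp: indicator_def)
    qed
    also have "\<dots> \<le> ennreal (exp (- (K / sg\<^sup>2) * (rho / 2)\<^sup>2 / 4) * sqrt (2 ^ CARD('n)))"
      unfolding phi_def using K sg rho by (intro mvn_density_tail symA formA) auto
    also have "\<dots> \<le> ennreal eta" by (rule ennreal_leI[OF eta])
    finally show "(\<integral>\<^sup>+b. ennreal (indicator {b. rho < norm (b - beta0)} b * phi b) \<partial>lborel) \<le> ennreal eta" .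
  qed (use prior near small pos phi0 in auto)
  then show ?thesis unfolding post S mvn_def phi_def .
qed

theorem theorem4:
  fixes Lam :: "nat \<Rightarrow> (nat \<Rightarrow> (real^('m::finite \<times> 'd::finite)) \<times> real) \<Rightarrow> (real^('m \<times> 'd)) measure"
    and beta0 :: "real^('m \<times> 'd)"
    and sg :: real
    and prior :: "real^('m \<times> 'd) \<Rightarrow> real"
  assumes sigma_pos: "sg > 0"
    and Lam_kernel: "\<And>j. Lam j \<in> PiM {..<j} (\<lambda>_. borel) \<rightarrow>\<^sub>M prob_algebra borel"
    and in_X: "\<And>n. AE h in hist Lam beta0 sg n. \<forall>j<n. fst (h j) \<in> Xset"
    and lmin_infty: "\<And>i. conv_prob_infty (hist Lam beta0 sg)
                         (\<lambda>n h. lambda_min (info_block i n h))"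
    and log_lmax: "\<And>i. conv_prob_zero (hist Lam beta0 sg)
                         (\<lambda>n h. ln (lambda_max (info_block i n h)) / lambda_min (info_block i n h))"
    and prior_nonneg: "\<And>b. prior b \<ge> 0"
    and prior_integrable: "integrable lborel prior"
    and prior_total: "(\<integral>b. prior b \<partial>lborel) = 1"
    and prior_cont: "continuous_on UNIV prior"
    and prior_bounded: "bounded (range prior)"
    and prior_pos: "prior beta0 > 0"
  shows "conv_prob_zero (hist Lam beta0 sg)
           (\<lambda>n h. tv_dist (posterior prior sg n h)
                           (mvn (beta_hat n h) (sg\<^sup>2 *\<^sub>R matrix_inv (XtX n h))))"
proof -
  let ?H = "hist Lam beta0 sg"
  let ?tv = "\<lambda>n h. tv_dist (posterior prior sg n h) (mvn (beta_hat n h) (sg\<^sup>2 *\<^sub>R matrix_inv (XtX n h)))"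
  have prior_meas: "prior \<in> borel_measurable borel" using prior_cont by (rule borel_measurable_continuous_onI)
  obtain M where "\<And>b. norm (prior b) \<le> M"
    using prior_bounded unfolding bounded_iff by auto
  then have M: "\<And>b. prior b \<le> M" by (metis abs_le_D1 real_norm_def)
  have M0: "0 < M" using prior_pos M[of beta0] by linarith
  show ?thesis
    unfolding conv_prob_zero_def
  proof (intro allI impI)
    fix eps dp :: real assume eps: "0 < eps" and dp: "0 < dp"
    \<comment> \<open>With \<open>M * eta = e\<close>, the first bound yields
      \<open>e + M * eta \<le> prior beta0 / 2\<close>, and the second makes the final bound
      \<open>8 * e / prior beta0\<close> at most \<open>eps\<close>.\<close>
    define e where "e = min (prior beta0 / 4) (eps * prior beta0 / 8)"
    define eta where "eta = e / M"
    have e: "0 < e" "e \<le> prior beta0 / 4" "e \<le> eps * prior beta0 / 8"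
      using eps prior_pos by (auto simp: e_def)
    have eta: "0 < eta" "M * eta = e" using e M0 by (auto simp: eta_def)
    obtain rho' where rho': "0 < rho'" "\<And>b. dist b beta0 < rho' \<Longrightarrow> dist (prior b) (prior beta0) < e"
      using prior_cont e(1) unfolding continuous_on_iff by (metis UNIV_I)
    \<comment> \<open>Halving turns the open ball given by continuity into a closed one.\<close>
    define rho where "rho = rho' / 2"
    have rho: "0 < rho" and near: "\<And>b. norm (b - beta0) \<le> rho \<Longrightarrow> \<bar>prior b - prior beta0\<bar> \<le> e"
    proof -
      show "0 < rho" using rho'(1) by (simp add: rho_def)
      fix b assume "norm (b - beta0) \<le> rho"
      then have "dist b beta0 < rho'" using rho'(1) by (simp add: dist_norm rho_def)
      from rho'(2)[OF this] show "\<bar>prior b - prior beta0\<bar> \<le> e" by (simp add: dist_real_def)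
    qed
    let ?m = "CARD('m)" and ?D = "CARD('d)" and ?p = "CARD('m \<times> 'd)"
    \<comment> \<open>Errors of at most \<open>del\<close> in each of the \<open>?m\<close> blocks
      combine to at most \<open>?m * del = rho / 2\<close>.\<close>
    define del where "del = rho / (2 * ?m)"
    have del: "0 < del" using rho by (simp add: del_def)
    \<comment> \<open>There are three bad events per block, of total probability at most
      \<open>3 * ?m * tau\<close>, which is below \<open>dp\<close>.\<close>
    define tau where "tau = dp / (4 * ?m)"
    have tau: "0 < tau" using dp by (simp add: tau_def)
    define W where "W = measure lborel (ball (0::real^'d) (del + 1))"
    \<comment> \<open>The added 1 makes \<open>B\<close> positive and the Markov bound
      \<open>W / B\<close> strictly smaller than \<open>tau\<close>.\<close>
    define B where "B = (W + 1) / tau"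
    have W: "0 \<le> W" by (simp add: W_def)
    have B: "0 < B" "W / B < tau" using W tau by (auto simp: B_def field_simps)
    define V where "V = unit_ball_vol (real ?D) * sg ^ ?D * exp (- (1/2))"
    have V: "0 < V" using sigma_pos by (simp add: V_def)
    define a where "a = del\<^sup>2 / (4 * sg\<^sup>2)"
    define a' where "a' = (rho / 2)\<^sup>2 / (4 * sg\<^sup>2)"
    have a: "0 < a" "0 < a'" using del rho sigma_pos by (auto simp: a_def a'_def)
    \<comment> \<open>The entries serve in turn to keep the eigenvalues away from 0, to keep the
      radius in the mixture bound at most 1, to let the mixture bound reach \<open>B\<close>, and to
      push the Gaussian tail below \<open>eta\<close>. The last two replace the exponential by a
      linear function through \<open>x \<le> exp x\<close>.\<close>
    define K where "K = Max {1, sg\<^sup>2, B / (V * a), sqrt (2 ^ ?p) / (eta * a')}"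
    have K: "1 \<le> K" "sg\<^sup>2 \<le> K" "B / (V * a) \<le> K" "sqrt (2 ^ ?p) / (eta * a') \<le> K"
      by (auto simp: K_def)
    have exp_ge: "x \<le> exp x" for x :: real using exp_ge_add_one_self[of x] by linarith
    have KB: "B \<le> V * exp (a * K)"
    proof -
      have "B \<le> V * (a * K)" using K(3) V a by (simp add: pos_divide_le_eq mult_ac)
      also have "\<dots> \<le> V * exp (a * K)" using V exp_ge by (intro mult_left_mono) auto
      finally show ?thesis .
    qed
    have Keta: "exp (- (K / sg\<^sup>2) * (rho / 2)\<^sup>2 / 4) * sqrt (2 ^ ?p) \<le> eta"
    proof -
      have "sqrt (2 ^ ?p) \<le> eta * (a' * K)" using K(4) eta a by (simp add: pos_divide_le_eq mult_ac)
      also have "\<dots> \<le> eta * exp (a' * K)" using eta exp_ge by (intro mult_left_mono) auto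
      finally have "exp (- (a' * K)) * sqrt (2 ^ ?p) \<le> exp (- (a' * K)) * (eta * exp (a' * K))"
        by (intro mult_left_mono) auto
      also have "\<dots> = eta" by (simp add: exp_minus)
      finally have "exp (- (a' * K)) * sqrt (2 ^ ?p) \<le> eta" .
      moreover have "- (K / sg\<^sup>2) * (rho / 2)\<^sup>2 / 4 = - (a' * K)" by (simp add: a'_def mult.commute)
      ultimately show ?thesis by (simp only:)
    qed
    \<comment> \<open>The largest ratio of \<open>ln\<close> of the top eigenvalue to the least
      eigenvalue for which half of the exponent still pays for the volume of the small ball.\<close>
    define kap where "kap = del\<^sup>2 / (2 * sg\<^sup>2 * ?D)"
    have kap: "0 < kap" using del sigma_pos by (simp add: kap_def)
    have "\<exists>N. \<forall>n\<ge>N. \<exists>A. \<forall>i. A i \<in> sets (?H n) \<and> {h \<in> space (?H n). lambda_min (info_block i n h) \<le> K} \<subseteq> A i \<and> measure (?H n) (A i) < tau"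
      using lmin_infty tau unfolding conv_prob_infty_def Bex_def by (intro choice_eventually_finite) simp
    then obtain N1 where N1: "\<And>n. N1 \<le> n \<Longrightarrow> \<exists>A. \<forall>i. A i \<in> sets (?H n) \<and> {h \<in> space (?H n). lambda_min (info_block i n h) \<le> K} \<subseteq> A i \<and> measure (?H n) (A i) < tau"
      by blast
    have "\<exists>N. \<forall>n\<ge>N. \<exists>A. \<forall>i. A i \<in> sets (?H n) \<and> {h \<in> space (?H n). kap < \<bar>ln (lambda_max (info_block i n h)) / lambda_min (info_block i n h)\<bar>} \<subseteq> A i \<and> measure (?H n) (A i) < tau"
      using log_lmax tau kap unfolding conv_prob_zero_def Bex_def by (intro choice_eventually_finite) simp
    then obtain N2 where N2: "\<And>n. N2 \<le> n \<Longrightarrow> \<exists>A. \<forall>i. A i \<in> sets (?H n) \<and> {h \<in> space (?H n). kap < \<bar>ln (lambda_max (info_block i n h)) / lambda_min (info_block i n h)\<bar>} \<subseteq> A i \<and> measure (?H n) (A i) < tau"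
      by blast
    show "\<exists>N. \<forall>n\<ge>N. \<exists>B\<in>sets (?H n). {h \<in> space (?H n). eps < \<bar>?tv n h\<bar>} \<subseteq> B \<and> measure (?H n) B < dp"
    proof (intro exI allI impI)
      fix n assume n: "max N1 N2 \<le> n"
      interpret H: prob_space "?H n" by (rule prob_space_hist[OF sigma_pos Lam_kernel])
      obtain B1 where
          B1: "\<And>i. B1 i \<in> sets (?H n)" "\<And>i. {h \<in> space (?H n). lambda_min (info_block i n h) \<le> K} \<subseteq> B1 i" "\<And>i. measure (?H n) (B1 i) < tau"
        using N1[of n] n by auto
      obtain B2 where
          B2: "\<And>i. B2 i \<in> sets (?H n)" "\<And>i. {h \<in> space (?H n). kap < \<bar>ln (lambda_max (info_block i n h)) / lambda_min (info_block i n h)\<bar>} \<subseteq> B2 i"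
          "\<And>i. measure (?H n) (B2 i) < tau"
        using N2[of n] n by auto
      define B3 where "B3 i = {h \<in> space (?H n). ennreal B \<le> block_mixture beta0 sg (del + 1) i n h}" for i
      have B3: "B3 i \<in> sets (?H n)" "measure (?H n) (B3 i) < tau" for i
        using block_mixture_tail[OF sigma_pos Lam_kernel B(1), of beta0 n "del + 1" i] B(2)
        by (auto simp: B3_def W_def)
      obtain B0 where B0: "{h \<in> space (?H n). \<not> (\<forall>j<n. fst (h j) \<in> Xset)} \<subseteq> B0" "B0 \<in> sets (?H n)" "emeasure (?H n) B0 = 0"
        using in_X[of n] by (rule AE_E)
      let ?U = "\<Union>i\<in>UNIV. B1 i \<union> B2 i \<union> B3 i"
      have "measure (?H n) (B0 \<union> ?U) \<le> measure (?H n) B0 + measure (?H n) ?U"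
        using B0 B1 B2 B3 by (intro measure_Un_le) auto
      also have "measure (?H n) B0 = 0" using B0 by (simp add: measure_def)
      also have "measure (?H n) ?U \<le> (\<Sum>i\<in>UNIV. measure (?H n) (B1 i \<union> B2 i \<union> B3 i))"
        using B1 B2 B3 by (intro measure_UNION_le) auto
      also have "\<dots> \<le> (\<Sum>i\<in>(UNIV::'m set). 3 * tau)"
      proof (rule sum_mono)
        fix i
        have "measure (?H n) (B1 i \<union> B2 i \<union> B3 i) \<le> measure (?H n) (B1 i \<union> B2 i) + measure (?H n) (B3 i)"
          using B1 B2 B3 by (intro measure_Un_le) auto
        also have "measure (?H n) (B1 i \<union> B2 i) \<le> measure (?H n) (B1 i) + measure (?H n) (B2 i)"
          using B1 B2 by (intro measure_Un_le) auto
        finally show "measure (?H n) (B1 i \<union> B2 i \<union> B3 i) \<le> 3 * tau"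
          using B1(3)[of i] B2(3)[of i] B3(2)[of i] by linarith
      qed
      also have "0 + (\<Sum>i\<in>(UNIV::'m set). 3 * tau) < dp" using dp by (simp add: tau_def)
      finally have small: "measure (?H n) (B0 \<union> ?U) < dp" by simp
      \<comment> \<open>Outside the bad events the argument is deterministic: each block error is at
        most \<open>del\<close>, hence \<open>beta_hat\<close> is close to \<open>beta0\<close>, and
        the total variation bound applies.\<close>
      have "{h \<in> space (?H n). eps < \<bar>?tv n h\<bar>} \<subseteq> B0 \<union> ?U"
      proof (rule ccontr)
        assume "\<not> ?thesis"
        then obtain h where h: "h \<in> space (?H n)" "eps < \<bar>?tv n h\<bar>" "h \<notin> B0" "\<And>i. h \<notin> B1 i" "\<And>i. h \<notin> B2 i" "\<And>i. h \<notin> B3 i"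
          by blast
        have X: "fst (h j) \<in> Xset" if "j < n" for j using h(1,3) B0(1) that by blast
        have lmin: "K \<le> lambda_min (info_block i n h)" for i
          using h(1) h(4)[of i] B1(2)[of i] by fastforce
        have lmax: "\<bar>ln (lambda_max (info_block i n h)) / lambda_min (info_block i n h)\<bar> \<le> del\<^sup>2 / (2 * sg\<^sup>2 * ?D)" for i
          using h(1) h(5)[of i] B2(2)[of i] unfolding kap_def by fastforce
        have mix: "block_mixture beta0 sg (del + 1) i n h < ennreal B" for i
          using h(1) h(6)[of i] unfolding B3_def by (auto simp: not_le)
        have blk: "norm (T i (beta_hat n h - beta0)) \<le> del" for i
          by (rule beta_hat_block_close[OF sigma_pos del X lmin K(1,2) lmax mix]) (use KB in \<open>simp_all add: V_def a_def\<close>)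
        have "(norm (beta_hat n h - beta0))\<^sup>2 \<le> (rho / 2)\<^sup>2"
        proof -
          have "(norm (beta_hat n h - beta0))\<^sup>2 \<le> (\<Sum>i\<in>(UNIV::'m set). del\<^sup>2)"
            unfolding norm_blocks[of "beta_hat n h - beta0"] by (intro sum_mono power_mono blk) auto
          also have "\<dots> = ?m * del\<^sup>2" by simp
          also have "\<dots> \<le> (?m * ?m) * del\<^sup>2" by (intro mult_right_mono) (auto simp: of_nat_mult[symmetric] simp del: of_nat_mult)
          also have "\<dots> = (rho / 2)\<^sup>2" by (simp add: del_def power2_eq_square)
          finally show ?thesis .
        qed
        then have close: "norm (beta_hat n h - beta0) \<le> rho / 2" by (rule power2_le_imp_le) (use rho in simp)
        have "\<bar>?tv n h\<bar> \<le> 4 * (e + M * eta) / prior beta0"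
        proof (rule tv_dist_posterior_mvn_le[where K = K and rho = rho])
          show "K * (norm b)\<^sup>2 \<le> b \<bullet> (XtX n h *v b)" for b by (rule XtX_form_ge[OF X lmin])
          show "0 < K" using K(1) by simp
          show "0 \<le> e" using e by simp
          show "e + M * eta \<le> prior beta0 / 2" using e eta by simp
        qed (fact sigma_pos close rho prior_meas prior_nonneg M near Keta prior_pos)+
        also have "\<dots> \<le> eps" using e(3) prior_pos by (simp add: eta(2) pos_divide_le_eq)
        finally show False using h(2) by simp
      qed
      moreover have "B0 \<union> ?U \<in> sets (?H n)" using B0 B1 B2 B3 by auto
      ultimately show "\<exists>B\<in>sets (?H n). {h \<in> space (?H n). eps < \<bar>?tv n h\<bar>} \<subseteq> B \<and> measure (?H n) B < dp"
        using small by blast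
    qed
  qed
qed

end
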